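(* For $2\le r\le 9$, every linear intersecting $r$-partite hypergraph (in which every vertex has positive degree) has covering number at most $r-1$.
   Context: A hypergraph $H$ is a set of non-empty subsets (lines) of a finite vertex set $V(H)$; the degree of a vertex is the number of lines containing it. $H$ is $r$-partite if $V(H)$ is partitioned into $r$ sets (sides) such that every line contains exactly one vertex from each side. A cover is a set of vertices meeting every line; the covering number $\tau(H)$ is the minimum size of a cover. $H$ is intersecting if every two lines share at least one vertex, and linear if every two distinct lines share at most one vertex. *)

theory Defs
  imports Main "HOL-Library.Disjoint_Sets"
begin

definition hypergraph :: "'a set \<Rightarrow> 'a set set \<Rightarrow> bool" where
  "hypergraph V H \<longleftrightarrow> finite V \<and> (\<forall>e\<in>H. e \<noteq> {} \<and> e \<subseteq> V)"

definition vertex_degree :: "'a set set \<Rightarrow> 'a \<Rightarrow> nat" where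
  "vertex_degree H v = card {e \<in> H. v \<in> e}"

text \<open>The sides are indexed by \<open>{..<r}\<close>. They may be empty, which (as every line meets
  every side) can only happen if there are no lines.\<close>

definition r_partite :: "nat \<Rightarrow> 'a set \<Rightarrow> 'a set set \<Rightarrow> bool" where
  "r_partite r V H \<longleftrightarrow>
     (\<exists>S :: nat \<Rightarrow> 'a set. (\<Union>i<r. S i) = V \<and> disjoint_family_on S {..<r} \<and>
        (\<forall>e\<in>H. \<forall>i<r. \<exists>!v. v \<in> e \<inter> S i))"

definition is_cover :: "'a set \<Rightarrow> 'a set set \<Rightarrow> 'a set \<Rightarrow> bool" where
  "is_cover V H C \<longleftrightarrow> C \<subseteq> V \<and> (\<forall>e\<in>H. C \<inter> e \<noteq> {})"

text \<open>For a hypergraph the minimum is over a finite set that contains \<open>card V\<close>.\<close>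

definition covering_number :: "'a set \<Rightarrow> 'a set set \<Rightarrow> nat" where
  "covering_number V H = Min (card ` {C. is_cover V H C})"

definition intersecting_hypergraph :: "'a set set \<Rightarrow> bool" where
  "intersecting_hypergraph H \<longleftrightarrow> (\<forall>e\<in>H. \<forall>f\<in>H. e \<inter> f \<noteq> {})"

definition linear_hypergraph :: "'a set set \<Rightarrow> bool" where
  "linear_hypergraph H \<longleftrightarrow> (\<forall>e\<in>H. \<forall>f\<in>H. e \<noteq> f \<longrightarrow> card (e \<inter> f) \<le> 1)"

end

theory Submission
  imports Defs Complex_Main
begin

text \<open>Suppose that no cover has fewer than \<open>r\<close> vertices. Then every side has at least \<open>r\<close> vertices,
  degrees lie between 2 and \<open>r - 2\<close>, and a line contains at most one vertex of degree 2. With \<open>n\<close> lines,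
  the degrees on a line sum to \<open>n + r - 1\<close> and those on a side to \<open>n\<close>, and a quadratic inequality
  between degrees leaves only \<open>r = 9\<close> with some vertex of degree 7. Such a vertex is far (not adjacent and on another
  side) from exactly one vertex of each line avoiding it. This gives \<open>n \<ge> 43\<close>; averaging the sum of
  inverse degrees over the lines then forces 81 vertices, \<open>n \<le> 49\<close>, and a short range for the number of
  vertices of degree 7. Two such vertices on different sides are always adjacent. A dimension count excludes
  \<open>n \<ge> 46\<close>, and for \<open>43 \<le> n \<le> 45\<close> dual solutions of linear programs in the degree profiles of lines
  and sides finish the proof.\<close>

section \<open>Lines, sides and adjacency\<close>

text \<open>The locale assumes the negated claim: no set of fewer than \<open>r\<close> vertices is
  a cover. The covers that it really tests are a side, a line without one vertex, and a line with
  two vertices traded for one; the rest is double counting. The quadratic inequality is a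
  discriminant test in the number of lines, and \<open>r = 9\<close> is the first value that escapes
  it: with degrees up to 7 the discriminant \<open>169 * 169 - 48 * 7 * 81\<close> is positive, with
  degrees up to 6 it is \<open>150 * 150 - 48 * 6 * 81\<close>, which is negative. For
  \<open>r = 9\<close>, two different vertices, one of them of degree 7, share a side, have a unique
  common line, or are far. So the sums over lines of \<open>c 7 * c k\<close> and over sides of
  \<open>s 7 * s k\<close> add up to a product of global counts, up to far pairs. A certificate that
  gives both sums the same coefficient need not know how vertices are distributed over the sides; it
  needs control of far pairs only. Hence the interest in adjacency of vertices of degree 7, and the
  separate treatment of the case where all lines, or all but one, have a vertex of degree 2: there
  such vertices keep far pairs few.\<close>

locale linear_intersecting_partite =
  fixes H :: "'a set set" and S :: "nat \<Rightarrow> 'a set" and r :: nat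
  assumes two_le_r: "2 \<le> r"
    and finite_side: "i < r \<Longrightarrow> finite (S i)"
    and disjoint_sides: "disjoint_family_on S {..<r}"
    and line_subset: "e \<in> H \<Longrightarrow> e \<subseteq> (\<Union>i<r. S i)"
    and card_line_side: "e \<in> H \<Longrightarrow> i < r \<Longrightarrow> card (e \<inter> S i) = 1"
    and card_line_line: "e \<in> H \<Longrightarrow> f \<in> H \<Longrightarrow> e \<noteq> f \<Longrightarrow> card (e \<inter> f) = 1"
    and vertex_on_line: "v \<in> (\<Union>i<r. S i) \<Longrightarrow> \<exists>e\<in>H. v \<in> e"
    and no_small_cover: "C \<subseteq> (\<Union>i<r. S i) \<Longrightarrow> card C < r \<Longrightarrow> \<exists>e\<in>H. C \<inter> e = {}"
begin

definition V :: "'a set" where "V = (\<Union>i<r. S i)"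
definition star :: "'a \<Rightarrow> 'a set set" where "star v = {e \<in> H. v \<in> e}"
definition deg :: "'a \<Rightarrow> nat" where "deg v = card (star v)"
definition adj :: "'a \<Rightarrow> 'a \<Rightarrow> bool" where "adj v w \<longleftrightarrow> (\<exists>e\<in>H. v \<in> e \<and> w \<in> e)"
definition side :: "'a \<Rightarrow> nat" where "side v = (THE i. i < r \<and> v \<in> S i)"
definition nbrs :: "'a \<Rightarrow> 'a set" where "nbrs x = {v \<in> V. v \<noteq> x \<and> adj x v}"
definition far :: "'a \<Rightarrow> 'a set" where "far x = {v \<in> V. side v \<noteq> side x \<and> \<not> adj x v}"

lemma side_eqI: "i < r \<Longrightarrow> v \<in> S i \<Longrightarrow> side v = i"
  unfolding side_def using disjoint_sides
  by (intro the_equality) (auto simp: disjoint_family_on_def)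

lemma sideD: assumes "v \<in> V" shows "side v < r" "v \<in> S (side v)"
  using assms side_eqI unfolding V_def by auto

lemma mem_side_iff: "v \<in> V \<Longrightarrow> i < r \<Longrightarrow> v \<in> S i \<longleftrightarrow> side v = i"
  using side_eqI sideD by auto

lemma side_subset: "i < r \<Longrightarrow> S i \<subseteq> V" unfolding V_def by auto

lemma finite_V [simp]: "finite V" unfolding V_def using finite_side by auto

lemma line_V: "e \<in> H \<Longrightarrow> e \<subseteq> V" using line_subset unfolding V_def by auto

lemma finite_line [simp]: "e \<in> H \<Longrightarrow> finite e" using line_V finite_V finite_subset by blast

lemma finite_H [simp]: "finite H"
  by (rule finite_subset[of H "Pow V"]) (use line_V in auto)

lemma finite_star [simp]: "finite (star v)" unfolding star_def by auto

lemma star_subset: "star v \<subseteq> H" unfolding star_def by auto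

lemma deg_pos: "v \<in> V \<Longrightarrow> 0 < deg v"
  using vertex_on_line[of v] unfolding V_def deg_def star_def by (auto simp: card_gt_0_iff)

lemma H_nonempty: "H \<noteq> {}" using no_small_cover[of "{}"] two_le_r by auto

lemma adj_sym: "adj v w \<longleftrightarrow> adj w v" unfolding adj_def by auto

lemma same_line:
  assumes "e \<in> H" "f \<in> H" "v \<in> e" "v \<in> f" "w \<in> e" "w \<in> f" "v \<noteq> w"
  shows "e = f"
proof (rule ccontr)
  assume "e \<noteq> f"
  then obtain u where "e \<inter> f = {u}" using card_line_line assms card_1_singletonE by metis
  then have "v = u" "w = u" using assms by blast+
  then show False using assms by simp
qed

lemma line_side_vertex:
  assumes "e \<in> H" "i < r" obtains v where "e \<inter> S i = {v}"
  using card_line_side[OF assms] card_1_singletonE by metis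

lemma line_meets_side: "e \<in> H \<Longrightarrow> i < r \<Longrightarrow> \<exists>v. v \<in> e \<and> v \<in> S i"
  using line_side_vertex by (metis IntE insertI1)

lemma meet_line: assumes "e \<in> H" "f \<in> H" shows "\<exists>v. v \<in> e \<and> v \<in> f"
proof (cases "e = f")
  case True
  then show ?thesis using line_meets_side[of e 0] assms two_le_r by auto
next
  case False
  then obtain u where "e \<inter> f = {u}" using card_line_line assms card_1_singletonE by metis
  then show ?thesis by auto
qed

lemma line_side_unique:
  assumes "e \<in> H" "v \<in> e" "w \<in> e" "side v = side w" shows "v = w"
proof -
  have "v \<in> V" "w \<in> V" using line_V assms by auto
  then have "side v < r" "v \<in> e \<inter> S (side v)" "w \<in> e \<inter> S (side v)"
    using sideD(1)[of v] sideD(2)[of v] sideD(2)[of w] assms by simp_all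
  then show ?thesis using line_side_vertex[OF assms(1)] by (metis singletonD)
qed

lemma adj_same_side: "adj v w \<Longrightarrow> side v = side w \<Longrightarrow> v = w"
  unfolding adj_def using line_side_unique by auto

lemma sum_V: "(\<Sum>v\<in>V. f v) = (\<Sum>i<r. \<Sum>v\<in>S i. f v)"
  unfolding V_def using disjoint_sides finite_side
  by (intro sum.UNION_disjoint) (auto simp: disjoint_family_on_def)

lemma card_line: assumes "e \<in> H" shows "card e = r"
proof -
  have "e = (\<Union>i<r. e \<inter> S i)" using line_subset[OF assms] by auto
  then have "card e = card (\<Union>i<r. e \<inter> S i)" by simp
  also have "\<dots> = (\<Sum>i<r. card (e \<inter> S i))"
    using disjoint_sides finite_side by (intro card_UN_disjoint) (auto simp: disjoint_family_on_def)
  finally show ?thesis using card_line_side[OF assms] by simp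
qed

section \<open>Double counting with vertex weights\<close>

lemma sum_lines_on:
  fixes f :: "'a \<Rightarrow> 'b::comm_ring_1"
  assumes "A \<subseteq> V"
  shows "(\<Sum>e\<in>H. \<Sum>v\<in>e \<inter> A. f v) = (\<Sum>v\<in>A. of_nat (deg v) * f v)"
proof -
  have fA: "finite A" using assms finite_V finite_subset by blast
  have "(\<Sum>e\<in>H. \<Sum>v\<in>e \<inter> A. f v) = (\<Sum>e\<in>H. \<Sum>v\<in>A. if v \<in> e then f v else 0)"
    by (rule sum.cong[OF refl], subst Int_commute) (rule sum.inter_restrict[OF fA])
  also have "\<dots> = (\<Sum>v\<in>A. \<Sum>e\<in>H. if v \<in> e then f v else 0)" by (rule sum.swap)
  also have "\<dots> = (\<Sum>v\<in>A. of_nat (deg v) * f v)"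
    by (intro sum.cong refl) (simp add: sum.If_cases deg_def star_def Int_def)
  finally show ?thesis .
qed

lemma sum_lines:
  fixes f :: "'a \<Rightarrow> 'b::comm_ring_1"
  shows "(\<Sum>e\<in>H. \<Sum>v\<in>e. f v) = (\<Sum>v\<in>V. of_nat (deg v) * f v)"
  using sum_lines_on[of V f] line_V by (simp add: Int_absorb2 cong: sum.cong)

lemma side_deg_sum: "i < r \<Longrightarrow> (\<Sum>v\<in>S i. deg v) = card H"
proof -
  assume i: "i < r"
  have "int (\<Sum>v\<in>S i. deg v) = (\<Sum>e\<in>H. \<Sum>v\<in>e \<inter> S i. 1)"
    using sum_lines_on[OF side_subset[OF i], of "\<lambda>_. 1::int"] by simp
  also have "\<dots> = int (card H)" using card_line_side i by simp
  finally show ?thesis by linarith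
qed

lemma sum_star:
  fixes f :: "'a \<Rightarrow> 'b::comm_ring_1"
  assumes x: "x \<in> V"
  shows "(\<Sum>e\<in>star x. \<Sum>v\<in>e. f v) = of_nat (deg x) * f x + (\<Sum>v\<in>nbrs x. f v)"
proof -
  have "(\<Sum>e\<in>star x. \<Sum>v\<in>e. f v) = (\<Sum>e\<in>star x. f x + (\<Sum>v\<in>e - {x}. f v))"
    by (intro sum.cong refl) (auto simp: star_def sum.remove)
  also have "\<dots> = of_nat (deg x) * f x + (\<Sum>e\<in>star x. \<Sum>v\<in>e - {x}. f v)"
    by (simp add: sum.distrib deg_def)
  also have "(\<Sum>e\<in>star x. \<Sum>v\<in>e - {x}. f v) = (\<Sum>v\<in>(\<Union>e\<in>star x. e - {x}). f v)"
    by (rule sum.UNION_disjoint[symmetric]) (use same_line in \<open>auto simp: star_def\<close>)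
  also have "(\<Union>e\<in>star x. e - {x}) = nbrs x"
    using line_V by (auto simp: star_def nbrs_def adj_def)
  finally show ?thesis .
qed

lemma sum_V_split:
  fixes f :: "'a \<Rightarrow> 'b::comm_ring_1"
  assumes x: "x \<in> V"
  shows "(\<Sum>v\<in>V. f v) = (\<Sum>v\<in>S (side x). f v) + (\<Sum>v\<in>nbrs x. f v) + (\<Sum>v\<in>far x. f v)"
proof -
  have V: "V = S (side x) \<union> nbrs x \<union> far x"
  proof -
    have "v \<in> S (side x) \<union> nbrs x \<union> far x" if "v \<in> V" for v
      using that x sideD(2)[OF x] mem_side_iff[OF that sideD(1)[OF x]] by (auto simp: nbrs_def far_def)
    moreover have "S (side x) \<union> nbrs x \<union> far x \<subseteq> V"
      using side_subset[OF sideD(1)[OF x]] by (auto simp: nbrs_def far_def)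
    ultimately show ?thesis by blast
  qed
  have fin: "finite (S (side x))" "finite (nbrs x)" "finite (far x)"
    using finite_side sideD(1)[OF x] by (auto simp: nbrs_def far_def)
  have d1: "S (side x) \<inter> nbrs x = {}"
    using adj_same_side[of x] side_eqI[OF sideD(1)[OF x]] by (fastforce simp: nbrs_def)
  have d2: "(S (side x) \<union> nbrs x) \<inter> far x = {}"
    using side_eqI[OF sideD(1)[OF x]] by (auto simp: nbrs_def far_def)
  have "(\<Sum>v\<in>V. f v) = (\<Sum>v\<in>S (side x) \<union> nbrs x \<union> far x. f v)" using V by simp
  also have "\<dots> = (\<Sum>v\<in>S (side x). f v) + (\<Sum>v\<in>nbrs x. f v) + (\<Sum>v\<in>far x. f v)"
    using fin d1 d2 by (simp add: sum.union_disjoint)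
  finally show ?thesis .
qed

text \<open>Eliminates the neighbours of \<open>x\<close>: whatever is summed over the lines through
  \<open>x\<close> is governed by a global sum, a side sum and a far sum.\<close>

lemma star_sum:
  fixes f :: "'a \<Rightarrow> 'b::comm_ring_1"
  assumes x: "x \<in> V"
  shows "(\<Sum>e\<in>star x. \<Sum>v\<in>e. f v) =
    of_nat (deg x) * f x + (\<Sum>v\<in>V. f v) - (\<Sum>v\<in>S (side x). f v) - (\<Sum>v\<in>far x. f v)"
  using sum_star[OF x, of f] sum_V_split[OF x, of f] by (simp add: algebra_simps)

text \<open>The lines through \<open>x\<close> hit another side in different vertices, since they
  meet only in \<open>x\<close>; what they miss there is far.\<close>

lemma star_side_sum:
  assumes x: "x \<in> V" and i: "i < r" "i \<noteq> side x"
  shows "card (S i) = deg x + card (far x \<inter> S i)"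
proof -
  let ?f = "\<lambda>v. if v \<in> S i then 1 else 0 :: int"
  have 1: "(\<Sum>v\<in>A. ?f v) = int (card (A \<inter> S i))" if "finite A" for A
    using that by (simp add: sum.If_cases)
  have x0: "x \<notin> S i" "S (side x) \<inter> S i = {}"
    using i x sideD[OF x] disjoint_sides by (auto simp: disjoint_family_on_def mem_side_iff)
  have "(\<Sum>e\<in>star x. \<Sum>v\<in>e. ?f v) = (\<Sum>e\<in>star x. 1)"
    using card_line_side[OF _ i(1)] 1 by (intro sum.cong refl) (auto simp: star_def)
  moreover have "far x \<subseteq> V" "finite (far x)" by (auto simp: far_def)
  ultimately show ?thesis
    using star_sum[OF x, of ?f] x0 1[of V] 1[of "S (side x)"] 1[of "far x"] finite_side sideD[OF x] side_subset[OF i(1)]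
    by (simp add: deg_def Int_absorb1)
qed

end

section \<open>Degrees\<close>

context linear_intersecting_partite
begin

definition Deg :: "nat \<Rightarrow> 'a set" where "Deg k = {v \<in> V. deg v = k}"

lemma Deg_V: "Deg k \<subseteq> V" unfolding Deg_def by auto

lemma finite_Deg [simp]: "finite (Deg k)" using Deg_V finite_V finite_subset by blast

lemma finite_far [simp]: "finite (far x)" unfolding far_def by simp

lemma far_V: "far x \<subseteq> V" unfolding far_def by auto

lemma card_side_ge: assumes "i < r" shows "r \<le> card (S i)"
proof (rule ccontr)
  assume "\<not> ?thesis"
  then obtain e where "e \<in> H" "S i \<inter> e = {}"
    using no_small_cover[of "S i"] side_subset[OF assms] unfolding V_def by auto
  then show False using line_meets_side[OF _ assms] by auto
qed

lemma card_V_ge: "r * r \<le> card V"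
proof -
  have "card V = (\<Sum>i<r. card (S i))" using sum_V[of "\<lambda>_. 1::nat"] by simp
  then show ?thesis using sum_mono[of "{..<r}" "\<lambda>_. r" "\<lambda>i. card (S i)"] card_side_ge by simp
qed

text \<open>\<open>e\<close> meets the \<open>deg x\<close> lines through \<open>x\<close> in
  different vertices and has one vertex on the side of \<open>x\<close>; its remaining vertices are
  far.\<close>

lemma card_line_far: assumes x: "x \<in> V" and e: "e \<in> H" "x \<notin> e"
  shows "card (e \<inter> far x) + deg x + 1 = r"
proof -
  have eV: "e \<subseteq> V" using line_V e by auto
  have s: "card (e \<inter> S (side x)) = 1" using card_line_side e sideD x by auto
  have U: "e \<inter> nbrs x = (\<Union>l\<in>star x. e \<inter> l)"
    using eV e by (auto simp: nbrs_def star_def adj_def)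
  have "card (\<Union>l\<in>star x. e \<inter> l) = (\<Sum>l\<in>star x. card (e \<inter> l))"
  proof (rule card_UN_disjoint)
    show "\<forall>i\<in>star x. \<forall>j\<in>star x. i \<noteq> j \<longrightarrow> (e \<inter> i) \<inter> (e \<inter> j) = {}"
      using same_line e by (auto simp: star_def)
  qed (use e in auto)
  also have "\<dots> = (\<Sum>l\<in>star x. 1)"
    using card_line_line e by (intro sum.cong) (auto simp: star_def)
  finally have n: "card (e \<inter> nbrs x) = deg x" using U by (simp add: deg_def)
  have "int (card (e \<inter> A)) = (\<Sum>v\<in>A. if v \<in> e then 1 else 0)" if "finite A" for A
    using that by (simp add: sum.If_cases Int_commute)
  moreover have "finite (S (side x))" "finite (nbrs x)"
    using finite_side sideD[OF x] by (auto simp: nbrs_def)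
  ultimately have "int (card (e \<inter> V)) = int (card (e \<inter> S (side x))) + int (card (e \<inter> nbrs x)) + int (card (e \<inter> far x))"
    using sum_V_split[OF x, of "\<lambda>v. if v \<in> e then 1 else 0 :: int"] by simp
  then show ?thesis using s n card_line[OF e(1)] eV by (simp add: Int_absorb2)
qed

lemma off_line: assumes "x \<in> V" shows "\<exists>e\<in>H. x \<notin> e"
  using no_small_cover[of "{x}"] assms two_le_r unfolding V_def by auto

lemma other_side: "\<exists>j<r. j \<noteq> i"
  using two_le_r by (intro exI[of _ "if i = 0 then 1 else 0"]) auto

text \<open>By \<open>card_line_far\<close> only degree \<open>r - 1\<close> needs an argument: it
  would leave no far vertex, so another side would have just \<open>r - 1\<close> vertices and be a
  small cover.\<close>

lemma deg_le: assumes x: "x \<in> V" shows "deg x + 2 \<le> r"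
proof (rule ccontr)
  assume "\<not> ?thesis"
  moreover obtain e where "e \<in> H" "x \<notin> e" using off_line[OF x] by auto
  ultimately have d: "deg x + 1 = r" using card_line_far[OF x] by fastforce
  have "far x = {}"
  proof (rule ccontr)
    assume "far x \<noteq> {}"
    then obtain v where v: "v \<in> far x" by auto
    then obtain f where f: "f \<in> H" "v \<in> f" using vertex_on_line[of v] by (auto simp: far_def V_def)
    then have "x \<notin> f" using v by (auto simp: far_def adj_def)
    then have "card (f \<inter> far x) = 0" using card_line_far[OF x f(1)] d by linarith
    then have "f \<inter> far x = {}" by simp
    then show False using f v by auto
  qed
  moreover obtain j where "j < r" "j \<noteq> side x" using other_side by auto
  ultimately have "card (S j) = deg x" using star_side_sum[OF x] by simp
  then show False using card_side_ge[OF \<open>j < r\<close>] d by simp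
qed

lemma sum_far_deg: assumes x: "x \<in> V"
  shows "(\<Sum>v\<in>far x. int (deg v)) = (int (card H) - int (deg x)) * (int r - 1 - int (deg x))"
proof -
  have "(\<Sum>v\<in>far x. int (deg v)) = (\<Sum>e\<in>H. int (card (e \<inter> far x)))"
    using sum_lines_on[OF far_V, of "\<lambda>_. 1::int"] by simp
  also have "\<dots> = (\<Sum>e\<in>H. if x \<in> e then 0 else int r - 1 - int (deg x))"
  proof (rule sum.cong[OF refl])
    fix e assume e: "e \<in> H"
    show "int (card (e \<inter> far x)) = (if x \<in> e then 0 else int r - 1 - int (deg x))"
    proof (cases "x \<in> e")
      case True
      then have "e \<inter> far x = {}" using e by (auto simp: far_def adj_def)
      then show ?thesis using True by simp
    next
      case False
      then show ?thesis using card_line_far[OF x e False] by auto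
    qed
  qed
  also have "\<dots> = int (card (H - star x)) * (int r - 1 - int (deg x))"
  proof -
    have "H \<inter> - {e. x \<in> e} = H - star x" by (auto simp: star_def)
    then show ?thesis by (simp add: sum.If_cases)
  qed
  also have "int (card (H - star x)) = int (card H) - int (deg x)"
    using star_subset[of x] card_mono[OF finite_H star_subset[of x]]
    by (simp add: card_Diff_subset deg_def of_nat_diff)
  finally show ?thesis .
qed

text \<open>Every other line meets \<open>e\<close> once, and \<open>e\<close> meets itself
  \<open>r\<close> times.\<close>

lemma line_deg_sum: assumes e: "e \<in> H"
  shows "(\<Sum>v\<in>e. int (deg v)) = int (card H) + int r - 1"
proof -
  have "(\<Sum>v\<in>e. int (deg v)) = (\<Sum>f\<in>H. int (card (f \<inter> e)))"
    using sum_lines_on[OF line_V[OF e], of "\<lambda>_. 1::int"] by simp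
  also have "\<dots> = int (card (e \<inter> e)) + (\<Sum>f\<in>H - {e}. int (card (f \<inter> e)))"
    using e by (simp add: sum.remove)
  also have "(\<Sum>f\<in>H - {e}. int (card (f \<inter> e))) = (\<Sum>f\<in>H - {e}. 1)"
    using card_line_line e by (intro sum.cong) auto
  also have "\<dots> = int (card H) - 1"
  proof -
    have "card H \<noteq> 0" using e by auto
    then have "1 \<le> card H" by linarith
    then show ?thesis using e by (simp add: of_nat_diff)
  qed
  finally show ?thesis using card_line[OF e] by simp
qed

lemma sum_deg: "(\<Sum>v\<in>V. int (deg v)) = int r * int (card H)"
proof -
  have "(\<Sum>v\<in>S i. int (deg v)) = int (card H)" if "i < r" for i
    using side_deg_sum[OF that] by (simp flip: of_nat_sum)
  then show ?thesis using sum_V[of "\<lambda>v. int (deg v)"] by simp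
qed

lemma sum_deg_sq: "(\<Sum>v\<in>V. int (deg v) * int (deg v)) = int (card H) * (int (card H) + int r - 1)"
  using sum_lines[of "\<lambda>v. int (deg v)"] line_deg_sum by simp

text \<open>A line through a vertex of degree 1 would be a cover even without that vertex.\<close>

lemma deg_ge_2: assumes v: "v \<in> V" shows "2 \<le> deg v"
proof (rule ccontr)
  assume "\<not> ?thesis"
  then have "card (star v) = 1" using deg_pos[OF v] by (simp add: deg_def)
  then obtain e where e: "star v = {e}" by (rule card_1_singletonE)
  then have eH: "e \<in> H" "v \<in> e" by (auto simp: star_def)
  have c: "card (e - {v}) = r - 1" using card_line[OF eH(1)] eH by simp
  obtain f where f: "f \<in> H" "(e - {v}) \<inter> f = {}"
    using no_small_cover[of "e - {v}"] c two_le_r line_subset[OF eH(1)] by fastforce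
  obtain u where u: "u \<in> e" "u \<in> f" using meet_line eH f by blast
  then have "v \<in> f" using f by auto
  then have "f = e" using f e by (auto simp: star_def)
  then have "e - {v} = {}" using f by auto
  then have "card (e - {v}) = 0" by (simp only: card.empty)
  then show False using c two_le_r by linarith
qed

text \<open>Dropping both vertices from \<open>e\<close> and adding a common point \<open>z\<close>
  of their other lines \<open>f\<close> and \<open>g\<close> would give a cover with at most
  \<open>r - 1\<close> vertices.\<close>

lemma deg_2_unique:
  assumes e: "e \<in> H" and u: "u \<in> e" "deg u = 2" and w: "w \<in> e" "deg w = 2"
  shows "u = w"
proof (rule ccontr)
  assume ne: "u \<noteq> w"
  have uV: "u \<in> V" using e u line_V by auto
  have other: "\<exists>f. star v = {e, f}" if "v \<in> e" "deg v = 2" for v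
  proof -
    obtain a b where ab: "star v = {a, b}" using \<open>deg v = 2\<close> by (auto simp: deg_def card_2_iff)
    have "e \<in> star v" using e that by (simp add: star_def)
    then have "e = a \<or> e = b" using ab by simp
    then show ?thesis using ab insert_commute[of a b "{}"] by metis
  qed
  obtain f where f: "star u = {e, f}" using other[OF u] by (elim exE)
  obtain g where g: "star w = {e, g}" using other[OF w] by (elim exE)
  have "f \<in> star u" "g \<in> star w" using f g by simp_all
  then have fg: "f \<in> H" "g \<in> H" "u \<in> f" "w \<in> g" by (simp_all add: star_def)
  obtain z where z: "z \<in> f" "z \<in> g" using meet_line fg by blast
  let ?C = "insert z (e - {u, w})"
  have r4: "4 \<le> r" using deg_le[OF uV] u by simp
  have ce: "card (e - {u, w}) = r - 2" using card_line[OF e] e u w ne by simp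
  have "card ?C \<le> Suc (r - 2)" using card_insert_le_m1[of "Suc (r - 2)" "e - {u, w}" z] ce r4 by simp
  then have "card ?C < r" using r4 by linarith
  moreover have "?C \<subseteq> (\<Union>i<r. S i)" using line_subset e fg z by auto
  ultimately obtain h where h: "h \<in> H" "?C \<inter> h = {}" using no_small_cover by blast
  have "h \<noteq> e"
  proof
    assume "h = e"
    then have "e - {u, w} = {}" using h by auto
    then have "card (e - {u, w}) = 0" by (simp only: card.empty)
    then show False using ce r4 by simp
  qed
  obtain p where p: "p \<in> e" "p \<in> h" using meet_line e h by blast
  then have "p = u \<or> p = w" using h(2) by blast
  then have "h \<in> star u \<or> h \<in> star w" using p h(1) by (auto simp: star_def)
  then have "h = f \<or> h = g" using f g \<open>h \<noteq> e\<close> by simp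
  then show False using z h(2) by blast
qed

lemma card_line_Deg2: assumes "e \<in> H" shows "card (e \<inter> Deg 2) \<le> 1"
proof -
  have "\<forall>u\<in>e \<inter> Deg 2. \<forall>w\<in>e \<inter> Deg 2. u = w"
    using deg_2_unique[OF assms] by (auto simp: Deg_def)
  then show ?thesis using assms by (subst One_nat_def, subst card_le_Suc0_iff_eq) auto
qed

lemma sum_line_Deg: "(\<Sum>e\<in>H. int (card (e \<inter> Deg k))) = int k * int (card (Deg k))"
proof -
  have "(\<Sum>e\<in>H. int (card (e \<inter> Deg k))) = (\<Sum>v\<in>Deg k. int (deg v))"
    using sum_lines_on[OF Deg_V, of "\<lambda>_. 1::int"] by simp
  then show ?thesis by (simp add: Deg_def)
qed

lemma card_free_lines: "int (card {e \<in> H. e \<inter> Deg 2 = {}}) = int (card H) - 2 * int (card (Deg 2))"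
proof -
  have "(\<Sum>e\<in>H. int (card (e \<inter> Deg 2))) = (\<Sum>e\<in>H. 1 - (if e \<inter> Deg 2 = {} then 1 else 0))"
  proof (rule sum.cong[OF refl])
    fix e assume e: "e \<in> H"
    then have "finite (e \<inter> Deg 2)" by auto
    then show "int (card (e \<inter> Deg 2)) = 1 - (if e \<inter> Deg 2 = {} then 1 else 0)"
      using card_line_Deg2[OF e] by (cases "e \<inter> Deg 2 = {}") (auto simp: card_gt_0_iff le_Suc_eq)
  qed
  also have "\<dots> = int (card H) - int (card {e \<in> H. e \<inter> Deg 2 = {}})"
    by (simp add: sum_subtractf sum.If_cases Int_def)
  finally show ?thesis using sum_line_Deg[of 2] by simp
qed

lemma Deg2_le: "2 * int (card (Deg 2)) \<le> int (card H)"
  using card_free_lines by linarith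

text \<open>Sums \<open>(deg v - 3) * (D - deg v)\<close> over all vertices: only degree 2 gives a
  negative term, namely \<open>- (D - 2)\<close>.\<close>

lemma quadratic_bound:
  fixes D m :: int
  assumes D: "3 \<le> D" and le: "\<And>v. v \<in> V \<Longrightarrow> int (deg v) \<le> D"
  shows "(D + 3) * (int r * int (card H)) - int (card H) * (int (card H) + int r - 1) - 3 * D * int (card V)
    \<ge> - (D - 2) * int (card (Deg 2))"
proof -
  have "(\<Sum>v\<in>V. - (D - 2) * (if v \<in> Deg 2 then 1 else 0)) \<le> (\<Sum>v\<in>V. (int (deg v) - 3) * (D - int (deg v)))"
  proof (rule sum_mono)
    fix v assume v: "v \<in> V"
    show "- (D - 2) * (if v \<in> Deg 2 then 1 else 0) \<le> (int (deg v) - 3) * (D - int (deg v))"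
    proof (cases "deg v = 2")
      case False
      then have "0 \<le> int (deg v) - 3" using deg_ge_2[OF v] by simp
      then show ?thesis using False le[OF v] by (simp add: Deg_def)
    qed (use v in \<open>simp add: Deg_def algebra_simps\<close>)
  qed
  moreover have "(\<Sum>v\<in>V. - (D - 2) * (if v \<in> Deg 2 then 1 else 0)) = - (D - 2) * int (card (Deg 2))"
    using Deg_V[of 2] by (simp add: sum_distrib_left[symmetric] sum.If_cases Int_absorb1)
  moreover have "(\<Sum>v\<in>V. (int (deg v) - 3) * (D - int (deg v)))
    = (D + 3) * (\<Sum>v\<in>V. int (deg v)) - (\<Sum>v\<in>V. int (deg v) * int (deg v)) - 3 * D * int (card V)"
    by (simp add: algebra_simps sum.distrib sum_subtractf sum_distrib_left)
  ultimately show ?thesis using sum_deg sum_deg_sq by simp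
qed

lemma r_eq_9:
  assumes "r \<le> 9"
  shows "r = 9 \<and> (\<exists>x\<in>V. deg x = 7)"
proof (rule ccontr)
  assume *: "\<not> ?thesis"
  define n where "n = int (card H)"
  have W: "int r * int r \<le> int (card V)" using card_V_ge by (metis of_nat_le_iff of_nat_mult)
  have a2: "2 * int (card (Deg 2)) \<le> n" using Deg2_le n_def by simp
  obtain e where "e \<in> H" using H_nonempty by auto
  then obtain x where x: "x \<in> V" using line_meets_side[of e 0] line_V two_le_r by auto
  then have r4: "4 \<le> r" using deg_le deg_ge_2 by fastforce
  have dle: "int (deg v) \<le> int r - 2" if "v \<in> V" for v using deg_le[OF that] by simp
  \<comment> \<open>With \<open>2 * card (Deg 2) \<le> n\<close> and
    \<open>card V \<ge> r * r\<close>, the bound becomes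
    \<open>2 * n * n - c * n + 6 * D * r * r \<le> 0\<close>; the hypothesis on \<open>c\<close>
    says that this quadratic has negative discriminant.\<close>
  have key: False
    if D: "3 \<le> D" "\<And>v. v \<in> V \<Longrightarrow> int (deg v) \<le> D"
      and k: "c * c < 48 * D * (int r * int r)" "c = 2 * ((D + 2) * int r + 1) + D - 2" for D c
  proof -
    have "- (D - 2) * n \<le> 2 * (- (D - 2) * int (card (Deg 2)))"
      using mult_left_mono[OF a2, of "D - 2"] D by (simp add: algebra_simps)
    also have "\<dots> \<le> 2 * ((D + 3) * (int r * n) - n * (n + int r - 1) - 3 * D * int (card V))"
      using quadratic_bound[OF D] unfolding n_def by simp
    also have "\<dots> \<le> 2 * ((D + 3) * (int r * n) - n * (n + int r - 1) - 3 * D * (int r * int r))"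
      using mult_left_mono[OF W, of "3 * D"] D by simp
    finally have "2 * n * n - c * n + 6 * D * (int r * int r) \<le> 0"
      unfolding k(2) by (simp add: algebra_simps)
    moreover have "0 \<le> (4 * n - c) * (4 * n - c)" by simp
    then have "0 \<le> 8 * (2 * n * n - c * n) + c * c" by (simp add: algebra_simps)
    moreover have "48 * D * (int r * int r) = 8 * (6 * D * (int r * int r))" by simp
    ultimately show False using k(1) by (smt (verit))
  qed
  consider "r = 4" | "r = 5" | "r = 6" | "r = 7" | "r = 8" | "r = 9" using r4 assms by linarith
  then show False
  proof cases
    case 1
    \<comment> \<open>\<open>D = 3\<close> rather than \<open>r - 2 = 2\<close>, because
      \<open>key\<close> requires \<open>3 \<le> D\<close>.\<close>
    have "int (deg v) \<le> 3" if "v \<in> V" for v using dle[OF that] 1 by simp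
    then show False by (rule key[of 3 43, rotated 1]) (simp_all add: 1)
  next
    case 2
    have "int (deg v) \<le> 3" if "v \<in> V" for v using dle[OF that] 2 by simp
    then show False by (rule key[of 3 53, rotated 1]) (simp_all add: 2)
  next
    case 3
    have "int (deg v) \<le> 4" if "v \<in> V" for v using dle[OF that] 3 by simp
    then show False by (rule key[of 4 76, rotated 1]) (simp_all add: 3)
  next
    case 4
    have "int (deg v) \<le> 5" if "v \<in> V" for v using dle[OF that] 4 by simp
    then show False by (rule key[of 5 103, rotated 1]) (simp_all add: 4)
  next
    case 5
    have "int (deg v) \<le> 6" if "v \<in> V" for v using dle[OF that] 5 by simp
    then show False by (rule key[of 6 134, rotated 1]) (simp_all add: 5)
  next
    case 6
    have d6: "int (deg v) \<le> 6" if "v \<in> V" for v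
    proof -
      have "deg v \<noteq> 7" using * 6 that by auto
      then show ?thesis using dle[OF that] 6 by simp
    qed
    show False by (rule key[of 6 150, OF _ d6]) (simp_all add: 6)
  qed
qed

end

section \<open>Vertices of degree 7 in nine sides\<close>

locale linear_intersecting_9 = linear_intersecting_partite H S 9
  for H :: "'a set set" and S :: "nat \<Rightarrow> 'a set" +
  assumes ex_Deg7: "Deg 7 \<noteq> {}"
begin

definition n :: int where "n = int (card H)"
definition a :: "nat \<Rightarrow> int" where "a k = int (card (Deg k))"
definition s :: "nat \<Rightarrow> nat \<Rightarrow> int" where "s k i = int (card (S i \<inter> Deg k))"
definition c :: "nat \<Rightarrow> 'a set \<Rightarrow> int" where "c k e = int (card (e \<inter> Deg k))"
definition free :: "'a set set" where "free = {e \<in> H. e \<inter> Deg 2 = {}}"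

lemma deg_le_7: "v \<in> V \<Longrightarrow> deg v \<le> 7" using deg_le by fastforce

lemma sum_indicator_Deg: "finite A \<Longrightarrow> (\<Sum>v\<in>A. if v \<in> Deg k then 1 else 0 :: int) = int (card (A \<inter> Deg k))"
  by (simp add: sum.If_cases)

lemma card_free: "int (card free) = n - 2 * a 2"
  using card_free_lines by (simp add: free_def n_def a_def)

lemma finite_side' [simp]: "i < 9 \<Longrightarrow> finite (S i)" using finite_side by auto

lemma card_sides: assumes "A \<subseteq> V" shows "int (card A) = (\<Sum>i<9. int (card (A \<inter> S i)))"
proof -
  have fA: "finite A" using assms finite_V finite_subset by blast
  have *: "(\<Sum>v\<in>B. if v \<in> A then 1 else 0) = int (card (A \<inter> B))" if "finite B" for B
    using that by (simp add: sum.If_cases Int_commute)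
  have "int (card A) = (\<Sum>v\<in>V. if v \<in> A then 1 else 0)" using *[of V] assms by (simp add: Int_absorb2)
  also have "\<dots> = (\<Sum>i<9. \<Sum>v\<in>S i. if v \<in> A then 1 else 0)" by (rule sum_V)
  also have "\<dots> = (\<Sum>i<9. int (card (A \<inter> S i)))" using * finite_side by (intro sum.cong) auto
  finally show ?thesis .
qed

lemma a_eq_sum_s: "a k = (\<Sum>i<9. s k i)"
  using card_sides[OF Deg_V, of k] by (simp add: a_def s_def Int_commute)

lemma deg_eq_classes:
  assumes "A \<subseteq> V"
  shows "int (card A) = (\<Sum>k\<in>{2..7}. int (card (A \<inter> Deg k)))"
    and "(\<Sum>v\<in>A. int (deg v)) = (\<Sum>k\<in>{2..7}. int k * int (card (A \<inter> Deg k)))"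
proof -
  have fA: "finite A" using assms finite_V finite_subset by blast
  have U: "A = (\<Union>k\<in>{2..7}. A \<inter> Deg k)"
  proof -
    have "deg v \<in> {2..7}" if "v \<in> A" for v using that assms deg_ge_2[of v] deg_le_7[of v] by auto
    then show ?thesis using assms by (auto simp: Deg_def)
  qed
  have dis: "\<forall>i\<in>{2..7::nat}. \<forall>j\<in>{2..7}. i \<noteq> j \<longrightarrow> (A \<inter> Deg i) \<inter> (A \<inter> Deg j) = {}"
    by (auto simp: Deg_def)
  have *: "(\<Sum>v\<in>A. f v) = (\<Sum>k\<in>{2..7}. \<Sum>v\<in>A \<inter> Deg k. f v)" for f :: "'a \<Rightarrow> int"
    using sum.UNION_disjoint[of "{2..7::nat}" "\<lambda>k. A \<inter> Deg k" f] fA dis U by simp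
  show "int (card A) = (\<Sum>k\<in>{2..7}. int (card (A \<inter> Deg k)))" using *[of "\<lambda>_. 1"] by simp
  have "(\<Sum>v\<in>A \<inter> Deg k. int (deg v)) = int k * int (card (A \<inter> Deg k))" for k
    by (simp add: Deg_def)
  then show "(\<Sum>v\<in>A. int (deg v)) = (\<Sum>k\<in>{2..7}. int k * int (card (A \<inter> Deg k)))"
    using *[of "\<lambda>v. int (deg v)"] by simp
qed

lemma sum_2_7: "(\<Sum>k\<in>{2..7::nat}. f k) = f 2 + f 3 + f 4 + f 5 + f 6 + (f 7 :: int)"
proof -
  have "{2..7::nat} = {2, 3, 4, 5, 6, 7}" by auto
  then show ?thesis by simp
qed

lemma side_profile: assumes "i < 9"
  shows "s 2 i + s 3 i + s 4 i + s 5 i + s 6 i + s 7 i = int (card (S i))"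
    and "2 * s 2 i + 3 * s 3 i + 4 * s 4 i + 5 * s 5 i + 6 * s 6 i + 7 * s 7 i = n"
proof -
  have "(\<Sum>v\<in>S i. int (deg v)) = n" using side_deg_sum[OF assms] by (simp add: n_def flip: of_nat_sum)
  then show "s 2 i + s 3 i + s 4 i + s 5 i + s 6 i + s 7 i = int (card (S i))"
    "2 * s 2 i + 3 * s 3 i + 4 * s 4 i + 5 * s 5 i + 6 * s 6 i + 7 * s 7 i = n"
    using deg_eq_classes[OF side_subset[OF assms]] unfolding sum_2_7 s_def by simp_all
qed

lemma line_profile: assumes "e \<in> H"
  shows "c 2 e + c 3 e + c 4 e + c 5 e + c 6 e + c 7 e = 9"
    and "2 * c 2 e + 3 * c 3 e + 4 * c 4 e + 5 * c 5 e + 6 * c 6 e + 7 * c 7 e = n + 8"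
    and "c 2 e \<le> 1"
  using deg_eq_classes[OF line_V[OF assms]] line_deg_sum[OF assms] card_line[OF assms] card_line_Deg2[OF assms]
  unfolding sum_2_7 c_def n_def by simp_all

lemma s_nonneg [simp]: "0 \<le> s k i" and c_nonneg [simp]: "0 \<le> c k e" and a_nonneg [simp]: "0 \<le> a k"
  by (simp_all add: s_def c_def a_def)

lemma card_side_ge_9: "i < 9 \<Longrightarrow> 9 \<le> int (card (S i))" using card_side_ge[of i] by simp

text \<open>The excesses \<open>deg v - 2\<close> on a side sum to at most \<open>n - 18\<close>,
  and a vertex of degree 7 accounts for 5.\<close>

lemma s7_le: assumes "i < 9" shows "5 * s 7 i + 18 \<le> n"
  using side_profile[OF assms] card_side_ge_9[OF assms] s_nonneg[of 3 i] s_nonneg[of 4 i] s_nonneg[of 5 i] s_nonneg[of 6 i]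
  by linarith

section \<open>Far vertices of a vertex of degree 7\<close>

lemma Deg7D: assumes "x \<in> Deg 7" shows "x \<in> V" "deg x = 7" "side x < 9" "x \<in> S (side x)"
  using assms sideD by (auto simp: Deg_def)

lemma far_deg_sum: "x \<in> Deg 7 \<Longrightarrow> (\<Sum>v\<in>far x. int (deg v)) = n - 7"
  using sum_far_deg[of x] by (simp add: Deg_def n_def)

lemma far_side: "x \<in> Deg 7 \<Longrightarrow> i < 9 \<Longrightarrow> i \<noteq> side x \<Longrightarrow> int (card (S i)) = 7 + int (card (far x \<inter> S i))"
  using star_side_sum[of x i] by (simp add: Deg_def)

lemma far_side_ge: "x \<in> Deg 7 \<Longrightarrow> i < 9 \<Longrightarrow> i \<noteq> side x \<Longrightarrow> 2 \<le> card (far x \<inter> S i)"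
  using far_side[of x i] card_side_ge_9[of i] by simp

lemma far_own_side: "far x \<inter> S (side x) = {}" if "x \<in> V"
  using side_eqI[OF sideD(1)[OF that]] by (fastforce simp: far_def)

lemma card_far_ge: assumes x: "x \<in> Deg 7" shows "16 \<le> card (far x)"
proof -
  have "int (card (far x)) = (\<Sum>i<9. int (card (far x \<inter> S i)))" by (rule card_sides[OF far_V])
  also have "\<dots> = (\<Sum>i\<in>{..<9} - {side x}. int (card (far x \<inter> S i)))"
    using sum.remove[of "{..<9}" "side x" "\<lambda>i. int (card (far x \<inter> S i))"] far_own_side Deg7D[OF x] by simp
  also have "\<dots> \<ge> (\<Sum>i\<in>{..<9} - {side x}. 2)"
    using far_side_ge[OF x] by (intro sum_mono) (metis DiffE insertI1 lessThan_iff of_nat_le_iff of_nat_numeral)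
  finally show ?thesis using Deg7D(3)[OF x] by simp
qed

lemma far_line: assumes x: "x \<in> Deg 7" and e: "e \<in> H" "x \<notin> e"
  obtains v where "e \<inter> far x = {v}"
proof -
  have "card (e \<inter> far x) = 1" using card_line_far[OF _ e] Deg7D[OF x] by simp
  then show thesis using that card_1_singletonE by metis
qed

lemma far_excess: assumes x: "x \<in> Deg 7"
  shows "(\<Sum>v\<in>far x. int (deg v) - 2) = n - 7 - 2 * int (card (far x))"
  using far_deg_sum[OF x] by (simp add: sum_subtractf)

lemma far_excess_le: assumes x: "x \<in> Deg 7" shows "(\<Sum>v\<in>far x. int (deg v) - 2) \<le> n - 39"
  using far_excess[OF x] card_far_ge[OF x] by simp

lemma n_ge_39: "39 \<le> n"
proof -
  obtain x where x: "x \<in> Deg 7" using ex_Deg7 by auto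
  have "0 \<le> (\<Sum>v\<in>far x. int (deg v) - 2)"
    using deg_ge_2 far_V[of x] by (intro sum_nonneg) fastforce
  then show ?thesis using far_excess_le[OF x] by simp
qed

text \<open>At least 16 far vertices share the degree sum \<open>n - 7\<close>, which is too small
  for most of them to have degree 3.\<close>

lemma far_Deg2: assumes x: "x \<in> Deg 7" shows "55 - n \<le> int (card (far x \<inter> Deg 2))"
proof -
  have "(\<Sum>v\<in>far x. 3 - (if v \<in> Deg 2 then 1 else 0)) \<le> (\<Sum>v\<in>far x. int (deg v))"
    using deg_ge_2 far_V[of x] by (intro sum_mono) (fastforce simp: Deg_def)
  then have "3 * int (card (far x)) - int (card (far x \<inter> Deg 2)) \<le> n - 7"
    using far_deg_sum[OF x] sum_indicator_Deg[of "far x" 2] by (simp add: sum_subtractf)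
  then show ?thesis using card_far_ge[OF x] by simp
qed

text \<open>The lines through \<open>x\<close> reach those vertices of degree 2 that are neither far
  nor on the side of \<open>x\<close>, one per line that is not free; \<open>far_Deg2\<close> limits
  their number.\<close>

lemma free_star: assumes x: "x \<in> Deg 7"
  shows "62 - n - a 2 + s 2 (side x) \<le> int (card (star x \<inter> free))"
proof -
  let ?f = "\<lambda>v. if v \<in> Deg 2 then 1 else 0 :: int"
  note xV = Deg7D(1)[OF x]
  have x2: "x \<notin> Deg 2" using x by (simp add: Deg_def)
  have fin: "finite (nbrs x)" "finite (S (side x))" using Deg7D(3)[OF x] by (auto simp: nbrs_def)
  have split: "a 2 = s 2 (side x) + int (card (nbrs x \<inter> Deg 2)) + int (card (far x \<inter> Deg 2))"
    using sum_V_split[OF xV, of ?f] fin sum_indicator_Deg Deg_V[of 2] by (simp add: a_def s_def Int_absorb1)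
  have "int (card (nbrs x \<inter> Deg 2)) = (\<Sum>e\<in>star x. \<Sum>v\<in>e. ?f v)"
    using sum_star[OF xV, of ?f] x2 fin sum_indicator_Deg by simp
  also have "\<dots> = (\<Sum>e\<in>star x. 1 - (if e \<in> free then 1 else 0))"
  proof (rule sum.cong[OF refl])
    fix e assume "e \<in> star x"
    then have e: "e \<in> H" by (simp add: star_def)
    show "(\<Sum>v\<in>e. ?f v) = 1 - (if e \<in> free then 1 else 0)"
      using card_line_Deg2[OF e] e sum_indicator_Deg[of e 2]
      by (cases "e \<inter> Deg 2 = {}") (auto simp: free_def card_gt_0_iff le_Suc_eq)
  qed
  also have "\<dots> = 7 - int (card (star x \<inter> free))"
    using Deg7D(2)[OF x] by (simp add: sum_subtractf sum.If_cases deg_def)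
  finally show ?thesis using split far_Deg2[OF x] by simp
qed

text \<open>The two stars share at most one line, so \<open>free_star\<close> for both vertices
  bounds \<open>card free = n - 2 * a 2\<close> from below; \<open>a 2\<close> cancels.\<close>

lemma two_Deg7: assumes x: "x \<in> Deg 7" "y \<in> Deg 7" "x \<noteq> y"
  shows "s 2 (side x) + s 2 (side y) \<le> 3 * n - 123"
proof -
  have ff: "finite free" by (simp add: free_def)
  have "\<forall>e\<in>(star x \<inter> free) \<inter> (star y \<inter> free). \<forall>f\<in>(star x \<inter> free) \<inter> (star y \<inter> free). e = f"
    using same_line[of _ _ x y] x(3) by (auto simp: star_def)
  then have 1: "card ((star x \<inter> free) \<inter> (star y \<inter> free)) \<le> 1"
    by (subst One_nat_def, subst card_le_Suc0_iff_eq) (simp_all add: ff)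
  have "card ((star x \<inter> free) \<union> (star y \<inter> free)) \<le> card free"
    using ff by (intro card_mono) auto
  then have "card (star x \<inter> free) + card (star y \<inter> free) \<le> card free + 1"
    using card_Un_Int[of "star x \<inter> free" "star y \<inter> free"] ff 1 by simp
  then show ?thesis using free_star[OF x(1)] free_star[OF x(2)] card_free by simp
qed

section \<open>Global degree counts and the lower bound 43 for the number of lines\<close>

lemma Deg_identities:
  shows "a 2 + a 3 + a 4 + a 5 + a 6 + a 7 = int (card V)"
    and "2 * a 2 + 3 * a 3 + 4 * a 4 + 5 * a 5 + 6 * a 6 + 7 * a 7 = 9 * n"
    and "4 * a 2 + 9 * a 3 + 16 * a 4 + 25 * a 5 + 36 * a 6 + 49 * a 7 = n * (n + 8)"
proof -
  have V: "V \<inter> Deg k = Deg k" for k using Deg_V by auto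
  show "a 2 + a 3 + a 4 + a 5 + a 6 + a 7 = int (card V)"
    "2 * a 2 + 3 * a 3 + 4 * a 4 + 5 * a 5 + 6 * a 6 + 7 * a 7 = 9 * n"
    using deg_eq_classes[of V] sum_deg unfolding sum_2_7 V a_def n_def by simp_all
  have "(\<Sum>e\<in>H. n + 8) = (\<Sum>e\<in>H. 2 * c 2 e + 3 * c 3 e + 4 * c 4 e + 5 * c 5 e + 6 * c 6 e + 7 * c 7 e)"
    using line_profile(2) by simp
  also have "\<dots> = 2 * (\<Sum>e\<in>H. c 2 e) + 3 * (\<Sum>e\<in>H. c 3 e) + 4 * (\<Sum>e\<in>H. c 4 e) + 5 * (\<Sum>e\<in>H. c 5 e)
      + 6 * (\<Sum>e\<in>H. c 6 e) + 7 * (\<Sum>e\<in>H. c 7 e)"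
    by (simp add: sum.distrib sum_distrib_left)
  finally show "4 * a 2 + 9 * a 3 + 16 * a 4 + 25 * a 5 + 36 * a 6 + 49 * a 7 = n * (n + 8)"
    using sum_line_Deg by (simp add: c_def n_def a_def)
qed

lemma card_V_ge_81: "81 \<le> int (card V)" using card_V_ge by simp

lemma a2_le: "2 * a 2 \<le> n" using Deg2_le by (simp add: a_def n_def)

text \<open>Sums \<open>(deg v - 3) * (6 - deg v)\<close>, which is \<open>- 4\<close> for degrees 2
  and 7 and nonnegative for the others.\<close>

lemma Deg7_quadratic: "n * n - 73 * n + 1458 \<le> 4 * (a 2 + a 7)"
proof -
  have *: "q - 73 * m + 1458 \<le> 4 * (a2 + a7)"
    if "a2 + a3 + a4 + a5 + a6 + a7 = w" "2 * a2 + 3 * a3 + 4 * a4 + 5 * a5 + 6 * a6 + 7 * a7 = 9 * m"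
      "4 * a2 + 9 * a3 + 16 * a4 + 25 * a5 + 36 * a6 + 49 * a7 = q + 8 * m"
      "81 \<le> w" "0 \<le> a4" "0 \<le> a5"
    for a2 a3 a4 a5 a6 a7 w m q :: int
    using that by (smt (z3))
  have "n * (n + 8) = n * n + 8 * n" by (simp add: distrib_left)
  then show ?thesis
    using *[OF Deg_identities(1,2) _ card_V_ge_81 a_nonneg a_nonneg] Deg_identities(3) by simp
qed

lemma n_ge_43: "43 \<le> n"
proof (rule ccontr)
  assume "\<not> 43 \<le> n"
  then consider "n = 39" | "n = 40" | "n = 41" | "n = 42" using n_ge_39 by linarith
  \<comment> \<open>For 39 and 40 lines \<open>3 * n - 123\<close> is negative, so there is a single
    vertex of degree 7, too few for \<open>Deg7_quadratic\<close>.\<close>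
  then have n: "n = 41 \<or> n = 42"
  proof cases
    case 3 then show ?thesis by simp
  next
    case 4 then show ?thesis by simp
  next
    case 1
    then have "\<forall>x\<in>Deg 7. \<forall>y\<in>Deg 7. x = y"
      using two_Deg7 s_nonneg by (smt (verit))
    then have "card (Deg 7) \<le> 1" by (subst One_nat_def, subst card_le_Suc0_iff_eq) auto
    then show ?thesis using Deg7_quadratic a2_le 1 by (simp add: a_def)
  next
    case 2
    then have "\<forall>x\<in>Deg 7. \<forall>y\<in>Deg 7. x = y"
      using two_Deg7 s_nonneg by (smt (verit))
    then have "card (Deg 7) \<le> 1" by (subst One_nat_def, subst card_le_Suc0_iff_eq) auto
    then show ?thesis using Deg7_quadratic a2_le 2 by (simp add: a_def)
  qed
  define J where "J = {i. i < 9 \<and> S i \<inter> Deg 7 \<noteq> {}}"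
  have fJ: "finite J" by (simp add: J_def)
  have a7: "17 \<le> a 7" using n
  proof
    assume "n = 41"
    then have "a 2 \<le> 20" "146 \<le> 4 * (a 2 + a 7)" using Deg7_quadratic a2_le by simp_all
    then show ?thesis by simp
  next
    assume "n = 42"
    then have "a 2 \<le> 21" "156 \<le> 4 * (a 2 + a 7)" using Deg7_quadratic a2_le by simp_all
    then show ?thesis by simp
  qed
  have "a 7 = (\<Sum>i\<in>J. s 7 i)"
    unfolding a_eq_sum_s by (rule sum.mono_neutral_right) (auto simp: J_def s_def)
  also have "\<dots> \<le> (\<Sum>i\<in>J. 4)" using s7_le n by (intro sum_mono) (fastforce simp: J_def)
  finally have J5: "5 \<le> card J" using a7 by simp
  have pair: "s 2 i + s 2 j \<le> 3" if "i \<in> J" "j \<in> J" "i \<noteq> j" for i j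
  proof -
    have "S i \<inter> Deg 7 \<noteq> {}" "S j \<inter> Deg 7 \<noteq> {}" "i < 9" "j < 9" using that by (simp_all add: J_def)
    then obtain x y where xy: "x \<in> S i" "x \<in> Deg 7" "y \<in> S j" "y \<in> Deg 7" by blast
    then have "side x = i" "side y = j" using side_eqI \<open>i < 9\<close> \<open>j < 9\<close> by simp_all
    moreover have "x \<noteq> y" using \<open>side x = i\<close> \<open>side y = j\<close> that(3) by auto
    ultimately show ?thesis using two_Deg7[OF xy(2,4)] n by auto
  qed
  \<comment> \<open>By \<open>pair\<close>, at most one side in \<open>J\<close> has two or more
    vertices of degree 2. Taking \<open>x\<close> on that side keeps it out of the count of far
    vertices.\<close>
  obtain i where i: "i \<in> J" "\<forall>j\<in>J - {i}. s 2 j \<le> 1"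
  proof (cases "\<exists>i\<in>J. 2 \<le> s 2 i")
    case True
    then obtain i where "i \<in> J" "2 \<le> s 2 i" by auto
    then show ?thesis using that pair by fastforce
  next
    case False
    moreover obtain i where "i \<in> J" using J5 by fastforce
    ultimately show ?thesis using that by fastforce
  qed
  then obtain x where x: "x \<in> S i" "x \<in> Deg 7" by (auto simp: J_def)
  have sx: "side x = i" using side_eqI x i by (auto simp: J_def)
  have ge: "0 \<le> int (deg v) - 2" if "v \<in> far x" for v using deg_ge_2[of v] that far_V by auto
  \<comment> \<open>Each other side in \<open>J\<close> has two vertices far from \<open>x\<close>,
    not both of degree 2, hence excess at least 1; only \<open>n - 39 \<le> 3\<close> is
    available.\<close>
  have "4 \<le> (\<Sum>j\<in>J - {i}. 1::int)" using J5 i(1) fJ by simp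
  also have "\<dots> \<le> (\<Sum>j\<in>J - {i}. \<Sum>v\<in>far x \<inter> S j. int (deg v) - 2)"
  proof (rule sum_mono)
    fix j assume j: "j \<in> J - {i}"
    then have j9: "j < 9" "j \<noteq> side x" using sx by (auto simp: J_def)
    have "\<not> far x \<inter> S j \<subseteq> Deg 2"
    proof
      assume "far x \<inter> S j \<subseteq> Deg 2"
      then have "card (far x \<inter> S j) \<le> card (S j \<inter> Deg 2)" using j9 by (intro card_mono) auto
      moreover have "s 2 j \<le> 1" using i(2) j by auto
      ultimately show False using far_side_ge[OF x(2) j9] by (simp add: s_def)
    qed
    then obtain v where v: "v \<in> far x \<inter> S j" "v \<notin> Deg 2" by auto
    then have "1 \<le> int (deg v) - 2" using deg_ge_2[of v] far_V by (fastforce simp: Deg_def)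
    also have "\<dots> \<le> (\<Sum>v\<in>far x \<inter> S j. int (deg v) - 2)"
      using v ge by (intro member_le_sum) auto
    finally show "1 \<le> (\<Sum>v\<in>far x \<inter> S j. int (deg v) - 2)" .
  qed
  also have "\<dots> = (\<Sum>v\<in>(\<Union>j\<in>J - {i}. far x \<inter> S j). int (deg v) - 2)"
    using disjoint_sides fJ
    by (intro sum.UNION_disjoint[symmetric]) (auto simp: J_def disjoint_family_on_def)
  also have "\<dots> \<le> (\<Sum>v\<in>far x. int (deg v) - 2)"
    using ge by (intro sum_mono2) auto
  finally show False using far_excess_le[OF x(2)] n by auto
qed

end

section \<open>Degree profiles\<close>

text \<open>The counts \<open>c3\<close> and \<open>c4\<close> are determined by the others.\<close>

definition all_profiles :: "int \<Rightarrow> (int \<Rightarrow> int \<Rightarrow> int \<Rightarrow> int \<Rightarrow> int \<Rightarrow> int \<Rightarrow> bool) \<Rightarrow> bool" where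
  "all_profiles N P \<longleftrightarrow> list_all (\<lambda>c7. list_all (\<lambda>c6. list_all (\<lambda>c5. list_all (\<lambda>c2.
     (let k = 9-c2-c5-c6-c7; m = N-2*c2-5*c5-6*c6-7*c7 in
       if 3*k \<le> m \<and> m \<le> 4*k then P c2 (4*k-m) (m-3*k) c5 c6 c7 else True))
     [0..1]) [0..9-c7-c6]) [0..9-c7]) [0..9]"

lemma all_profilesD:
  assumes P: "all_profiles N P"
    and nonneg: "0 \<le> c2" "0 \<le> c3" "0 \<le> c4" "0 \<le> c5" "0 \<le> c6" "0 \<le> c7" and c2: "c2 \<le> 1"
    and s: "c2 + c3 + c4 + c5 + c6 + c7 = 9"
    and t: "2*c2 + 3*c3 + 4*c4 + 5*c5 + 6*c6 + 7*c7 = N"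
  shows "P c2 c3 c4 c5 c6 c7"
proof -
  have e: "9-c2-c5-c6-c7 = c3+c4" using s by simp
  have e': "N-2*c2-5*c5-6*c6-7*c7 = 3*c3+4*c4" using t by simp
  have b: "c7 \<in> set [0..9]" "c6 \<in> set [0..9-c7]" "c5 \<in> set [0..9-c7-c6]" "c2 \<in> set [0..1]"
    using nonneg c2 s by auto
  have "let k = 9-c2-c5-c6-c7; m = N-2*c2-5*c5-6*c6-7*c7 in
       if 3*k \<le> m \<and> m \<le> 4*k then P c2 (4*k-m) (m-3*k) c5 c6 c7 else True"
    using P b unfolding all_profiles_def list_all_iff by blast
  then show ?thesis unfolding Let_def e e' using nonneg by simp
qed

text \<open>Used with \<open>N = n - 18\<close>, the largest possible sum of
  \<open>deg v - 2\<close> on a side. Degree 2 costs nothing and degree 3 is left as slack, so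
  neither is enumerated.\<close>

definition all_sides :: "int \<Rightarrow> (int \<Rightarrow> int \<Rightarrow> int \<Rightarrow> int \<Rightarrow> bool) \<Rightarrow> bool" where
  "all_sides N P \<longleftrightarrow> list_all (\<lambda>s7. list_all (\<lambda>s6. list_all (\<lambda>s5. list_all (\<lambda>s4. P s4 s5 s6 s7)
     [0..(N-5*s7-4*s6-3*s5) div 2]) [0..(N-5*s7-4*s6) div 3]) [0..(N-5*s7) div 4]) [0..N div 5]"

lemma all_sidesD:
  assumes P: "all_sides N P" and nonneg: "0 \<le> s4" "0 \<le> s5" "0 \<le> s6" "0 \<le> s7"
    and s: "5*s7 + 4*s6 + 3*s5 + 2*s4 \<le> N"
  shows "P s4 s5 s6 s7"
proof -
  have "s7 \<in> set [0..N div 5]" "s6 \<in> set [0..(N-5*s7) div 4]" "s5 \<in> set [0..(N-5*s7-4*s6) div 3]"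
    "s4 \<in> set [0..(N-5*s7-4*s6-3*s5) div 2]"
    using nonneg s by auto
  then show ?thesis using P unfolding all_sides_def list_all_iff by blast
qed

text \<open>Integral substitute for Cauchy-Schwarz, sharpest when \<open>q\<close> is the floor of
  the mean.\<close>

lemma consecutive_nonneg: "0 \<le> (x - q) * (x - q - 1)" for x q :: int
  by (cases "x \<le> q") (auto intro: mult_nonpos_nonpos)

context linear_intersecting_9
begin

definition E :: "nat \<Rightarrow> int" where "E k = (\<Sum>x\<in>Deg 7. int (card (far x \<inter> Deg k)))"
definition CC :: "nat \<Rightarrow> int" where "CC k = (\<Sum>e\<in>H. c 7 e * c k e)"
definition T :: "nat \<Rightarrow> int" where "T k = (\<Sum>i<9. s 7 i * s k i)"
text \<open>On a line \<open>c 2 e\<close> is 0 or 1, so the factor \<open>1 - c 2 e\<close> selects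
  the free lines.\<close>

definition Fr :: "nat \<Rightarrow> int" where "Fr k = (\<Sum>e\<in>H. (1 - c 2 e) * c k e)"

lemma E_nonneg: "0 \<le> E k" unfolding E_def by (simp add: sum_nonneg)

lemma sum_Deg7_side: "(\<Sum>x\<in>Deg 7. f (side x)) = (\<Sum>i<9. s 7 i * f i)" for f :: "nat \<Rightarrow> int"
proof -
  have U: "Deg 7 = (\<Union>i<9. S i \<inter> Deg 7)" using Deg7D by blast
  have "(\<Sum>x\<in>Deg 7. f (side x)) = (\<Sum>x\<in>(\<Union>i<9. S i \<inter> Deg 7). f (side x))" using U by simp
  also have "\<dots> = (\<Sum>i<9. \<Sum>x\<in>S i \<inter> Deg 7. f (side x))"
    using disjoint_sides by (intro sum.UNION_disjoint) (auto simp: disjoint_family_on_def)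
  also have "\<dots> = (\<Sum>i<9. \<Sum>x\<in>S i \<inter> Deg 7. f i)"
    using side_eqI by (intro sum.cong refl) auto
  finally show ?thesis by (simp add: s_def)
qed

lemma star_c: assumes x: "x \<in> Deg 7"
  shows "(\<Sum>e\<in>star x. c k e) = (if k = 7 then 7 else 0) + a k - s k (side x) - int (card (far x \<inter> Deg k))"
proof -
  let ?f = "\<lambda>v. if v \<in> Deg k then 1 else 0 :: int"
  note xV = Deg7D(1)[OF x]
  have "(\<Sum>e\<in>star x. c k e) = (\<Sum>e\<in>star x. \<Sum>v\<in>e. ?f v)"
    by (rule sum.cong[OF refl]) (simp add: c_def star_def sum_indicator_Deg)
  also have "\<dots> = 7 * ?f x + (\<Sum>v\<in>V. ?f v) - (\<Sum>v\<in>S (side x). ?f v) - (\<Sum>v\<in>far x. ?f v)"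
    using star_sum[OF xV, of ?f] Deg7D(2)[OF x] by simp
  also have "(\<Sum>v\<in>V. ?f v) = a k"
    using sum_indicator_Deg[of V k] Deg_V[of k] by (simp add: a_def Int_absorb1)
  also have "(\<Sum>v\<in>S (side x). ?f v) = s k (side x)"
    using sum_indicator_Deg[of "S (side x)" k] Deg7D(3)[OF x] by (simp add: s_def)
  also have "(\<Sum>v\<in>far x. ?f v) = int (card (far x \<inter> Deg k))" by (rule sum_indicator_Deg) simp
  also have "7 * ?f x = (if k = 7 then 7 else 0)" using x by (simp add: Deg_def)
  finally show ?thesis .
qed

text \<open>A pair of degrees 7 and \<open>k\<close> is on one side (\<open>T\<close>), far
  (\<open>E\<close>), or on exactly one common line. For \<open>k = 7\<close> the pairs
  \<open>(x, x)\<close> lie on seven lines each, whence the extra term.\<close>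

lemma CC_eq: "CC k = (if k = 7 then 7 * a 7 else 0) + a 7 * a k - T k - E k"
proof -
  have "CC k = (\<Sum>e\<in>H. \<Sum>x\<in>Deg 7. if x \<in> e then c k e else 0)"
    unfolding CC_def by (rule sum.cong[OF refl]) (simp add: sum.If_cases c_def Int_commute)
  also have "\<dots> = (\<Sum>x\<in>Deg 7. \<Sum>e\<in>H. if x \<in> e then c k e else 0)" by (rule sum.swap)
  also have "\<dots> = (\<Sum>x\<in>Deg 7. \<Sum>e\<in>star x. c k e)"
    by (rule sum.cong[OF refl]) (simp add: sum.If_cases star_def Int_def)
  also have "\<dots> = (\<Sum>x\<in>Deg 7. (if k = 7 then 7 else 0) + a k - s k (side x) - int (card (far x \<inter> Deg k)))"
    by (rule sum.cong[OF refl]) (rule star_c)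
  also have "\<dots> = (if k = 7 then 7 * a 7 else 0) + a 7 * a k - T k - E k"
    using sum_Deg7_side[of "s k"]
    by (simp add: sum.distrib sum_subtractf E_def T_def a_def algebra_simps)
  finally show ?thesis .
qed

lemma sum_c: "(\<Sum>e\<in>H. c k e) = int k * a k"
  using sum_line_Deg[of k] by (simp add: c_def a_def)

lemma line_cert:
  assumes "all_profiles (n + 8) (\<lambda>c2 c3 c4 c5 c6 c7. 0 \<le> G + f2*c2 + f3*c3 + f4*c4 + f5*c5 + f6*c6 + f7*c7
     + h4*(c7*c4) + h5*(c7*c5) + h6*(c7*c6) + h7*(c7*c7) + p4*((1-c2)*c4) + p5*((1-c2)*c5))"
  shows "0 \<le> n*G + f2*(2*a 2) + f3*(3*a 3) + f4*(4*a 4) + f5*(5*a 5) + f6*(6*a 6) + f7*(7*a 7)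
     + h4*CC 4 + h5*CC 5 + h6*CC 6 + h7*CC 7 + p4*Fr 4 + p5*Fr 5"
proof -
  have "0 \<le> (\<Sum>e\<in>H. G + f2*c 2 e + f3*c 3 e + f4*c 4 e + f5*c 5 e + f6*c 6 e + f7*c 7 e
     + h4*(c 7 e*c 4 e) + h5*(c 7 e*c 5 e) + h6*(c 7 e*c 6 e) + h7*(c 7 e*c 7 e)
     + p4*((1-c 2 e)*c 4 e) + p5*((1-c 2 e)*c 5 e))"
    by (rule sum_nonneg, rule all_profilesD[OF assms]) (simp_all add: line_profile)
  also have "\<dots> = n*G + f2*(\<Sum>e\<in>H. c 2 e) + f3*(\<Sum>e\<in>H. c 3 e) + f4*(\<Sum>e\<in>H. c 4 e) + f5*(\<Sum>e\<in>H. c 5 e)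
     + f6*(\<Sum>e\<in>H. c 6 e) + f7*(\<Sum>e\<in>H. c 7 e)
     + h4*CC 4 + h5*CC 5 + h6*CC 6 + h7*CC 7 + p4*Fr 4 + p5*Fr 5"
    unfolding CC_def Fr_def n_def sum.distrib sum_distrib_left[symmetric] by simp
  finally show ?thesis by (simp add: sum_c)
qed

lemma side_cert:
  assumes "all_sides (n - 18) (\<lambda>s4 s5 s6 s7. 0 \<le> D + F4*s4 + F5*s5 + F6*s6 + F7*s7
     + h4*(s7*s4) + h5*(s7*s5) + h6*(s7*s6) + h7*(s7*s7))"
  shows "0 \<le> 9*D + F4*a 4 + F5*a 5 + F6*a 6 + F7*a 7 + h4*T 4 + h5*T 5 + h6*T 6 + h7*T 7"
proof -
  have "0 \<le> (\<Sum>i<9. D + F4*s 4 i + F5*s 5 i + F6*s 6 i + F7*s 7 i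
     + h4*(s 7 i*s 4 i) + h5*(s 7 i*s 5 i) + h6*(s 7 i*s 6 i) + h7*(s 7 i*s 7 i))"
  proof (rule sum_nonneg, rule all_sidesD[OF assms])
    fix i :: nat assume "i \<in> {..<9}"
    then have i: "i < 9" by simp
    show "5 * s 7 i + 4 * s 6 i + 3 * s 5 i + 2 * s 4 i \<le> n - 18"
      using side_profile[OF i] card_side_ge_9[OF i] s_nonneg[of 3 i] by linarith
  qed simp_all
  also have "\<dots> = 9*D + F4*a 4 + F5*a 5 + F6*a 6 + F7*a 7 + h4*T 4 + h5*T 5 + h6*T 6 + h7*T 7"
    unfolding T_def a_eq_sum_s sum.distrib sum_distrib_left[symmetric] by simp
  finally show ?thesis .
qed

lemma CC_7_ge: "(2*q + 1) * (7 * a 7) - n * (q * (q + 1)) \<le> CC 7"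
proof -
  have "0 \<le> (\<Sum>e\<in>H. (c 7 e - q) * (c 7 e - q - 1))" by (intro sum_nonneg consecutive_nonneg)
  also have "\<dots> = (\<Sum>e\<in>H. c 7 e * c 7 e - (2*q + 1) * c 7 e + q * (q + 1))"
    by (rule sum.cong[OF refl]) (simp add: algebra_simps)
  also have "\<dots> = CC 7 - (2*q + 1) * (\<Sum>e\<in>H. c 7 e) + n * (q * (q + 1))"
    unfolding CC_def n_def sum.distrib sum_subtractf sum_distrib_left[symmetric] by (simp add: algebra_simps)
  finally show ?thesis by (simp add: sum_c)
qed

lemma T_7_ge: "(2*q + 1) * a 7 - 9 * (q * (q + 1)) \<le> T 7"
proof -
  have "0 \<le> (\<Sum>i<9. (s 7 i - q) * (s 7 i - q - 1))" by (intro sum_nonneg consecutive_nonneg)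
  also have "\<dots> = (\<Sum>i<9. s 7 i * s 7 i - (2*q + 1) * s 7 i + q * (q + 1))"
    by (rule sum.cong[OF refl]) (simp add: algebra_simps)
  also have "\<dots> = T 7 - (2*q + 1) * (\<Sum>i<9. s 7 i) + 9 * (q * (q + 1))"
    unfolding T_def sum.distrib sum_subtractf sum_distrib_left[symmetric] by simp
  finally show ?thesis by (simp add: a_eq_sum_s)
qed

end

section \<open>Range of the number of vertices of degree 7\<close>

text \<open>An upper bound for \<open>\<Sum>e. (c 7 e)\<^sup>2\<close> when there are \<open>A\<close> vertices of degree 7: the number of
  flags plus the number of ordered pairs on different sides, the latter being maximal when the
  vertices are spread evenly over the sides.\<close>

definition sq_max :: "int \<Rightarrow> int" where
  "sq_max A = A * A + 7 * A - ((2 * (A div 9) + 1) * A - 9 * ((A div 9) * (A div 9 + 1)))"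

text \<open>Tests \<open>CC_7_ge\<close> against the upper bound, with \<open>q\<close> the floor of
  the mean of \<open>c 7\<close> over \<open>m\<close> lines.\<close>

definition spread :: "int \<Rightarrow> int \<Rightarrow> bool" where
  "spread m A \<longleftrightarrow> (let q = 7 * A div m in (2*q + 1) * (7 * A) - m * (q * (q + 1))) \<le> sq_max A"

text \<open>A weight \<open>(G, B, K, C)\<close> bounds the sum over a line of \<open>2520 / deg v\<close> by
  \<open>G + B * c7 + K * c7\<^sup>2 + C * c2\<close>; summed over all lines, the left side is 2520 times the number of vertices.\<close>

definition weight_bound :: "int \<Rightarrow> int \<times> int \<times> int \<times> int \<Rightarrow> int \<Rightarrow> int" where
  "weight_bound m = (\<lambda>(G, B, K, C) A. m * G + 7 * B * A + K * sq_max A + C * (2 * (m div 2)))"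

text \<open>\<open>K\<close> and \<open>C\<close> must be nonnegative because the sums of
  \<open>c7 * c7\<close> and \<open>c2\<close> get replaced by upper bounds.\<close>

definition weight_ok :: "int \<Rightarrow> int \<times> int \<times> int \<times> int \<Rightarrow> bool" where
  "weight_ok m = (\<lambda>(G, B, K, C). 0 \<le> K \<and> 0 \<le> C \<and>
     all_profiles (m + 8) (\<lambda>c2 c3 c4 c5 c6 c7. 1260*c2 + 840*c3 + 630*c4 + 504*c5 + 420*c6 + 360*c7
       \<le> G + B * c7 + K * (c7 * c7) + C * c2))"

text \<open>Every conceivable \<open>A\<close> must fail \<open>spread\<close>, or be refuted by a
  weight allowing fewer than 81 vertices, or be listed in \<open>R\<close> with a weight allowing
  fewer than 82.\<close>

definition range_check :: "int \<Rightarrow> (int \<times> int \<times> int \<times> int) list \<Rightarrow> int list \<Rightarrow> bool" where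
  "range_check m ws R \<longleftrightarrow> list_all (weight_ok m) ws \<and>
     list_all (\<lambda>A. spread m A \<longrightarrow> list_ex (\<lambda>w. weight_bound m w A < 2520 * 81) ws \<or>
       (A \<in> set R \<and> list_ex (\<lambda>w. weight_bound m w A < 2520 * 82) ws)) [0..9 * ((m - 18) div 5)]"

context linear_intersecting_9
begin

lemma CC_7_le: "CC 7 \<le> sq_max (a 7)"
  using CC_eq[of 7] T_7_ge[of "a 7 div 9"] E_nonneg[of 7] by (simp add: sq_max_def)

lemma weight_bound: assumes "weight_ok n w" shows "2520 * int (card V) \<le> weight_bound n w (a 7)"
proof -
  obtain G B K C where w: "w = (G, B, K, C)" by (cases w)
  have K: "0 \<le> K" "0 \<le> C" using assms w by (auto simp: weight_ok_def)
  have "all_profiles (n + 8) (\<lambda>c2 c3 c4 c5 c6 c7. 0 \<le> G + (C - 1260)*c2 + (- 840)*c3 + (- 630)*c4 + (- 504)*c5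
     + (- 420)*c6 + (B - 360)*c7 + 0*(c7*c4) + 0*(c7*c5) + 0*(c7*c6) + K*(c7*c7) + 0*((1-c2)*c4) + 0*((1-c2)*c5))"
    using assms w by (simp add: weight_ok_def algebra_simps)
  from line_cert[OF this]
  have "2520 * (a 2 + a 3 + a 4 + a 5 + a 6 + a 7) \<le> n * G + 7 * B * a 7 + K * CC 7 + C * (2 * a 2)"
    by (simp add: algebra_simps)
  also have "\<dots> \<le> n * G + 7 * B * a 7 + K * sq_max (a 7) + C * (2 * (n div 2))"
  proof -
    have "2 * a 2 \<le> 2 * (n div 2)" using a2_le by simp
    then show ?thesis using mult_left_mono[OF CC_7_le K(1)] mult_left_mono[OF _ K(2)] by (simp add: add_mono)
  qed
  finally show ?thesis using Deg_identities(1) by (simp add: weight_bound_def w)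
qed

lemma range_checkD: assumes "range_check n ws R"
  shows "a 7 \<in> set R \<and> card V = 81"
proof -
  have s7: "s 7 i \<le> (n - 18) div 5" if "i < 9" for i using s7_le[OF that] by simp
  have "a 7 \<le> (\<Sum>i<9::nat. (n - 18) div 5)" unfolding a_eq_sum_s by (rule sum_mono) (use s7 in simp)
  then have "a 7 \<in> set [0..9 * ((n - 18) div 5)]" by simp
  moreover have "spread n (a 7)"
    using order_trans[OF CC_7_ge CC_7_le] by (simp add: spread_def Let_def)
  ultimately have *: "list_ex (\<lambda>w. weight_bound n w (a 7) < 2520 * 81) ws \<or>
       (a 7 \<in> set R \<and> list_ex (\<lambda>w. weight_bound n w (a 7) < 2520 * 82) ws)"
    using assms unfolding range_check_def list_all_iff by blast
  have w: "2520 * int (card V) \<le> weight_bound n w (a 7)" if "w \<in> set ws" for w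
    using weight_bound that assms unfolding range_check_def list_all_iff by blast
  have "\<not> list_ex (\<lambda>w. weight_bound n w (a 7) < 2520 * 81) ws"
    using w card_V_ge_81 by (fastforce simp: list_ex_iff)
  then obtain v where "a 7 \<in> set R" "v \<in> set ws" "weight_bound n v (a 7) < 2520 * 82"
    using * by (auto simp: list_ex_iff)
  then show ?thesis using w[of v] card_V_ge_81 by linarith
qed

lemma n_le_51: "n \<le> 51"
proof -
  have "- 5 * a 2 \<le> 90 * n - n * (n + 8) - 21 * int (card V)"
    using quadratic_bound[of 7] deg_le_7 by (simp add: n_def a_def add.commute)
  then have "2 * (n * n) - 169 * n + 3402 \<le> 0"
    using a2_le card_V_ge_81 by (simp add: algebra_simps)
  then have le: "2 * (n * n) + 3402 \<le> 169 * n" by simp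
  show ?thesis
  proof (rule ccontr)
    assume "\<not> n \<le> 51"
    \<comment> \<open>This product is \<open>2 * n * n - 169 * n + 3402\<close> minus 22, so the
      quadratic is positive from 52 on.\<close>
    then have "0 \<le> (n - 52) * (2 * n - 65)" by (intro mult_nonneg_nonneg) auto
    then have "169 * n \<le> 2 * (n * n) + 3380" by (simp add: algebra_simps)
    then show False using le by linarith
  qed
qed

lemma n_cases:
  obtains "n = 43" "a 7 \<in> {22, 23, 24, 25, 26}" "card V = 81"
  | "n = 44" "a 7 \<in> {27, 28, 29}" "card V = 81"
  | "n = 45" "a 7 \<in> {32, 33}" "card V = 81"
  | "46 \<le> n" "n \<le> 49" "35 \<le> a 7" "card V = 81"
proof -
  \<comment> \<open>Each row pairs weights with the values of \<open>a 7\<close> that survive them;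
    the empty lists for 50 and 51 exclude these \<open>n\<close>.\<close>
  have r43: "range_check 43 [(4704,-144,42,0), (4764,-15,6,0), (4434,35,1,210)] [22..26]" by code_simp
  have r44: "range_check 44 [(4620,-116,28,0)] [27..29]" by code_simp
  have r45: "range_check 45 [(4524,-82,18,0), (5040,-312,42,0)] [32..33]" by code_simp
  have r46: "range_check 46 [(4424,-63,13,0), (4884,-246,30,0)] [35..39]" by code_simp
  have r47: "range_check 47 [(4305,-27,6,0)] [37..43]" by code_simp
  have r48: "range_check 48 [(4116,24,0,0), (3432,102,6,0)] [41..51]" by code_simp
  have r49: "range_check 49 [(3276,90,6,0), (4200,0,0,0)] [48..54]" by code_simp
  have r50: "range_check 50 [(3132,78,6,0)] []" by code_simp
  have r51: "range_check 51 [(3720,0,0,0)] []" by code_simp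
  consider "n = 43" | "n = 44" | "n = 45" | "n = 46" | "n = 47" | "n = 48" | "n = 49" | "n = 50" | "n = 51"
    using n_ge_43 n_le_51 by linarith
  then show thesis
  proof cases
    case 1
    have *: "a 7 \<in> set [22..26] \<and> card V = 81" using range_checkD[of _ "[22..26]", unfolded 1, OF r43] .
    show thesis by (rule that(1)) (use 1 * in simp_all)
  next
    case 2
    have *: "a 7 \<in> set [27..29] \<and> card V = 81" using range_checkD[of _ "[27..29]", unfolded 2, OF r44] .
    show thesis by (rule that(2)) (use 2 * in simp_all)
  next
    case 3
    have *: "a 7 \<in> set [32..33] \<and> card V = 81" using range_checkD[of _ "[32..33]", unfolded 3, OF r45] .
    show thesis by (rule that(3)) (use 3 * in simp_all)
  next
    case 4
    have *: "a 7 \<in> set [35..39] \<and> card V = 81" using range_checkD[of _ "[35..39]", unfolded 4, OF r46] .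
    show thesis by (rule that(4)) (use 4 * in auto)
  next
    case 5
    have *: "a 7 \<in> set [37..43] \<and> card V = 81" using range_checkD[of _ "[37..43]", unfolded 5, OF r47] .
    show thesis by (rule that(4)) (use 5 * in auto)
  next
    case 6
    have *: "a 7 \<in> set [41..51] \<and> card V = 81" using range_checkD[of _ "[41..51]", unfolded 6, OF r48] .
    show thesis by (rule that(4)) (use 6 * in auto)
  next
    case 7
    have *: "a 7 \<in> set [48..54] \<and> card V = 81" using range_checkD[of _ "[48..54]", unfolded 7, OF r49] .
    show thesis by (rule that(4)) (use 7 * in auto)
  next
    case 8 then show thesis using range_checkD[of _ "[]", unfolded 8, OF r50] by simp
  next
    case 9 then show thesis using range_checkD[of _ "[]", unfolded 9, OF r51] by simp
  qed
qed

end

section \<open>Adjacency of the vertices of degree 7\<close>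

text \<open>Gaussian elimination: equation \<open>e\<close> with pivot \<open>z\<close> removes the
  unknown \<open>z\<close> from the other equations, and \<open>t\<close> is its value by back
  substitution.\<close>

lemma linear_system_nontrivial:
  fixes m :: "'e \<Rightarrow> 'x \<Rightarrow> real"
  assumes "finite Q" "finite X" "card Q < card X"
  shows "\<exists>u. (\<exists>x\<in>X. u x \<noteq> 0) \<and> (\<forall>e\<in>Q. (\<Sum>x\<in>X. m e x * u x) = 0)"
  using assms
proof (induction Q arbitrary: X m rule: finite_induct)
  case empty
  then obtain x where "x \<in> X" by fastforce
  then show ?case by (intro exI[of _ "\<lambda>_. 1"]) auto
next
  case (insert e Q)
  show ?case
  proof (cases "\<forall>x\<in>X. m e x = 0")
    case True
    have "card Q < card X" using insert.prems insert.hyps by simp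
    then obtain u where "\<exists>x\<in>X. u x \<noteq> 0" "\<forall>f\<in>Q. (\<Sum>x\<in>X. m f x * u x) = 0"
      using insert.IH insert.prems(1) by blast
    then show ?thesis using True by (intro exI[of _ u]) simp
  next
    case False
    then obtain z where z: "z \<in> X" "m e z \<noteq> 0" by auto
    let ?X = "X - {z}"
    have "card Q < card ?X" using insert.prems insert.hyps z by simp
    then obtain u where u: "\<exists>x\<in>?X. u x \<noteq> 0"
      "\<forall>f\<in>Q. (\<Sum>x\<in>?X. (m f x - m f z / m e z * m e x) * u x) = 0"
      using insert.IH[of ?X "\<lambda>f x. m f x - m f z / m e z * m e x"] insert.prems(1) by auto
    define t where "t = - (\<Sum>x\<in>?X. m e x * u x) / m e z"
    let ?u = "u(z := t)"
    have split: "(\<Sum>x\<in>X. m f x * ?u x) = m f z * t + (\<Sum>x\<in>?X. m f x * u x)" for f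
    proof -
      have "(\<Sum>x\<in>X. m f x * ?u x) = m f z * ?u z + (\<Sum>x\<in>?X. m f x * ?u x)"
        using z insert.prems(1) by (intro sum.remove) auto
      also have "(\<Sum>x\<in>?X. m f x * ?u x) = (\<Sum>x\<in>?X. m f x * u x)" by (rule sum.cong) auto
      finally show ?thesis by simp
    qed
    have "(\<Sum>x\<in>X. m f x * ?u x) = 0" if "f \<in> Q" for f
    proof -
      have "(\<Sum>x\<in>?X. m f x * u x) = m f z / m e z * (\<Sum>x\<in>?X. m e x * u x)"
        using u(2) that by (simp add: algebra_simps sum_subtractf sum_distrib_left)
      then show ?thesis unfolding split unfolding t_def by simp
    qed
    moreover have "(\<Sum>x\<in>X. m e x * ?u x) = 0" unfolding split unfolding t_def using z by simp
    moreover have "\<exists>x\<in>X. ?u x \<noteq> 0" using u(1) by auto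
    ultimately show ?thesis by (intro exI[of _ ?u]) auto
  qed
qed

context linear_intersecting_9
begin

lemma card_side_9: assumes "card V = 81" "i < 9" shows "card (S i) = 9"
proof (rule ccontr)
  assume ne: "card (S i) \<noteq> 9"
  have "9 < card (S i)" using card_side_ge[OF assms(2)] ne by linarith
  then have "\<exists>j\<in>{..<9::nat}. 9 < card (S j)" using assms(2) by auto
  then have "(\<Sum>j<9::nat. 9) < (\<Sum>j<9. card (S j))"
    using card_side_ge by (intro sum_strict_mono_ex1) auto
  then show False using sum_V[of "\<lambda>_. 1::nat"] assms(1) by simp
qed

lemma far_side_2:
  assumes "card V = 81" "x \<in> Deg 7" "i < 9" "i \<noteq> side x"
  shows "card (far x \<inter> S i) = 2"
  using far_side[OF assms(2-4)] card_side_9[OF assms(1,3)] by simp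

lemma far_on_line:
  assumes "x \<in> Deg 7" "e \<in> H" "v \<in> e" "w \<in> e" "v \<in> far x" "w \<in> far x"
  shows "v = w"
proof -
  have "x \<notin> e" using assms(2,3,5) by (auto simp: far_def adj_def)
  then obtain u where "e \<inter> far x = {u}" using far_line assms(1,2) by blast
  then have "v = u" "w = u" using assms by blast+
  then show ?thesis by simp
qed

lemma far_sym: "v \<in> V \<Longrightarrow> w \<in> far v \<Longrightarrow> v \<in> far w"
  using adj_sym by (auto simp: far_def)

lemma two_lines: assumes "v \<in> V" obtains p q where "p \<in> H" "q \<in> H" "v \<in> p" "v \<in> q" "p \<noteq> q"
proof -
  have "\<not> card (star v) \<le> Suc 0" using deg_ge_2[OF assms] by (simp add: deg_def)
  then obtain p q where "p \<in> star v" "q \<in> star v" "p \<noteq> q"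
    using card_le_Suc0_iff_eq[OF finite_star] by blast
  then show thesis using that by (auto simp: star_def)
qed

text \<open>If two vertices of degree 7 on different sides \<open>A\<close> and \<open>C\<close> were not adjacent, they would be
  far from the same vertices on the other seven sides. Hence all lines through the second vertex
  of \<open>C\<close> far from the first one would pass through the second vertex of \<open>A\<close> far from the second one.\<close>

lemma Deg7_adjacent:
  assumes 81: "card V = 81" and x: "x \<in> Deg 7" and z: "z \<in> Deg 7"
  shows "z \<notin> far x"
proof
  assume zf: "z \<in> far x"
  have xV: "x \<in> V" and zV: "z \<in> V" using Deg7D x z by auto
  have xf: "x \<in> far z" using far_sym[OF xV zf] .
  have sides: "side x \<noteq> side z" using zf by (auto simp: far_def)
  \<comment> \<open>A line joining \<open>z\<close> to a vertex far from \<open>x\<close> would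
    carry two vertices far from \<open>x\<close>. Equality follows since both sets have two
    elements.\<close>
  have eq: "far x \<inter> S j = far z \<inter> S j" if j: "j < 9" "j \<noteq> side x" "j \<noteq> side z" for j
  proof (rule card_subset_eq)
    show "finite (far z \<inter> S j)" by simp
    show "card (far x \<inter> S j) = card (far z \<inter> S j)" using far_side_2[OF 81] x z j by simp
    show "far x \<inter> S j \<subseteq> far z \<inter> S j"
    proof
      fix v assume v: "v \<in> far x \<inter> S j"
      have vV: "v \<in> V" "side v = j" using v far_V side_eqI[OF j(1)] by auto
      have "\<not> adj z v"
      proof
        assume "adj z v"
        then obtain q where q: "q \<in> H" "z \<in> q" "v \<in> q" unfolding adj_def by (elim bexE conjE)
        have "z = v" using far_on_line[OF x q zf] v by simp
        then show False using vV j by simp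
      qed
      then show "v \<in> far z \<inter> S j" using v vV j by (simp add: far_def)
    qed
  qed
  have "card (far x \<inter> S (side z)) = 2" using far_side_2[OF 81 x] sides Deg7D(3)[OF z] by simp
  then have "far x \<inter> S (side z) \<noteq> {z}" by auto
  moreover have "z \<in> far x \<inter> S (side z)" using zf Deg7D(4)[OF z] by simp
  ultimately obtain y where y: "y \<in> far x" "y \<in> S (side z)" "y \<noteq> z" by blast
  have yV: "y \<in> V" and ys: "side y = side z" using y far_V side_eqI[OF Deg7D(3)[OF z]] by auto
  have "card (far z \<inter> S (side x)) = 2" using far_side_2[OF 81 z] sides Deg7D(3)[OF x] by simp
  then obtain b1 b2 where b: "far z \<inter> S (side x) = {b1, b2}" by (auto simp: card_2_iff)
  \<comment> \<open>A line through \<open>y\<close> avoids \<open>x\<close> and \<open>z\<close>, so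
    it has one vertex far from \<open>z\<close>. On the seven other sides this vertex would also be
    far from \<open>x\<close>, but \<open>y\<close> already takes that place.\<close>
  have *: "\<exists>v. v \<in> q \<and> v \<in> {b1, b2} \<and> v \<noteq> x" if q: "q \<in> H" "y \<in> q" for q
  proof -
    have xq: "x \<notin> q" using q y(1) by (auto simp: far_def adj_def)
    have zq: "z \<notin> q" using line_side_unique[OF q(1) _ q(2)] ys y(3) by auto
    obtain v where v: "q \<inter> far z = {v}" using far_line[OF z q(1) zq] .
    then have vq: "v \<in> q" "v \<in> far z" by auto
    have vV: "v \<in> V" "side v < 9" "v \<in> S (side v)" using vq far_V sideD by auto
    have "side v = side x"
    proof (rule ccontr)
      assume ne: "side v \<noteq> side x"
      have "side v \<noteq> side z" using vq by (simp add: far_def)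
      have "v \<in> far z \<inter> S (side v)" using vV vq by simp
      then have "v \<in> far x \<inter> S (side v)" unfolding eq[OF vV(2) ne \<open>side v \<noteq> side z\<close>] .
      then have "v \<in> far x" by simp
      then have "v = y" using far_on_line[OF x q(1) vq(1) q(2) _ y(1)] by simp
      then show False using ys \<open>side v \<noteq> side z\<close> by simp
    qed
    then have "v \<in> far z \<inter> S (side x)" using vq vV by simp
    then have "v \<in> {b1, b2}" unfolding b .
    then show ?thesis using vq(1) xq by (intro exI[of _ v]) auto
  qed
  have "x \<in> far z \<inter> S (side x)" using xf Deg7D(4)[OF x] by simp
  then have xb: "x \<in> {b1, b2}" unfolding b .
  obtain p q where pq: "p \<in> H" "q \<in> H" "y \<in> p" "y \<in> q" "p \<noteq> q" using two_lines[OF yV] .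
  obtain v where v: "v \<in> p" "v \<in> {b1, b2}" "v \<noteq> x" using *[OF pq(1,3)] by (elim exE conjE)
  obtain w where w: "w \<in> q" "w \<in> {b1, b2}" "w \<noteq> x" using *[OF pq(2,4)] by (elim exE conjE)
  have "w = v" using v w xb by auto
  then have vw: "v \<in> p" "v \<in> q" using v w by simp_all
  have "v \<in> far z" using v(2) unfolding b[symmetric] by simp
  then have "side v \<noteq> side y" using ys by (simp add: far_def)
  then have "v \<noteq> y" by auto
  then show False using same_line[OF pq(1,2) vw(1,2) pq(3,4)] pq(5) by simp
qed

lemma E_7: "card V = 81 \<Longrightarrow> E 7 = 0"
  using Deg7_adjacent by (auto simp: E_def intro!: sum.neutral)

text \<open>A function \<open>u\<close> on the lines whose sum \<open>w v\<close> over the lines through \<open>v\<close> vanishes for all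
  vertices but those of degree 7 and one more must vanish.\<close>

lemma a7_le: assumes 81: "card V = 81" and n: "46 \<le> n" "n \<le> 49" shows "a 7 + n \<le> 80"
proof (rule ccontr)
  assume big: "\<not> a 7 + n \<le> 80"
  obtain x0 where x0: "x0 \<in> Deg 7" using ex_Deg7 by auto
  define i0 where "i0 = side x0"
  have i0: "i0 < 9" "x0 \<in> S i0" using Deg7D[OF x0] by (auto simp: i0_def)
  have s7: "s 7 i \<le> 6" if "i < 9" for i using s7_le[OF that] n by simp
  have "\<not> S i0 \<subseteq> Deg 7"
  proof
    assume "S i0 \<subseteq> Deg 7"
    then have "s 7 i0 = 9" using card_side_9[OF 81 i0(1)] by (simp add: s_def Int_absorb2)
    then show False using s7[OF i0(1)] by simp
  qed
  \<comment> \<open>Releasing the equation at \<open>y\<close> lowers their number from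
    \<open>81 - a 7\<close> to \<open>80 - a 7\<close>, which is needed for \<open>n = 46\<close>,
    \<open>a 7 = 35\<close>. The side of \<open>x0\<close> is used to have
    \<open>al i0 \<ge> 1\<close> below.\<close>
  then obtain y where y: "y \<in> S i0" "y \<notin> Deg 7" by auto
  have yV: "y \<in> V" and sy: "side y = i0" using y side_subset i0 side_eqI by auto
  define Q where "Q = V - insert y (Deg 7)"
  have "card Q = 81 - (card (Deg 7) + 1)"
    unfolding Q_def using 81 yV y Deg_V[of 7] by (subst card_Diff_subset) auto
  moreover have "80 < card (Deg 7) + card H" "0 < card H" using big n by (simp_all add: a_def n_def)
  ultimately have "card Q < card H" by arith
  moreover have "finite Q" by (simp add: Q_def)
  ultimately obtain u :: "'a set \<Rightarrow> real" where u: "\<exists>e\<in>H. u e \<noteq> 0"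
    and u0: "\<forall>v\<in>Q. (\<Sum>e\<in>H. (if v \<in> e then 1 else 0) * u e) = 0"
    using linear_system_nontrivial[of Q H "\<lambda>v e. if v \<in> e then 1 else 0"] finite_H by blast
  define w where "w v = (\<Sum>e\<in>H. (if v \<in> e then 1 else 0) * u e)" for v
  define t where "t = (\<Sum>e\<in>H. u e)"
  have w0: "w v = 0" if "v \<in> V" "v \<notin> Deg 7" "v \<noteq> y" for v using u0 that by (simp add: w_def Q_def)
  have w_star: "w v = (\<Sum>e\<in>star v. u e)" for v
    by (simp add: w_def star_def if_distrib[of "\<lambda>x. x * _"] sum.If_cases Int_def cong: if_cong)
  have w_on: "(\<Sum>v\<in>A. w v) = (\<Sum>e\<in>H. of_nat (card (e \<inter> A)) * u e)" if "finite A" for A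
  proof -
    have "(\<Sum>v\<in>A. w v) = (\<Sum>e\<in>H. \<Sum>v\<in>A. (if v \<in> e then 1 else 0) * u e)"
      unfolding w_def by (rule sum.swap)
    also have "\<dots> = (\<Sum>e\<in>H. of_nat (card (e \<inter> A)) * u e)"
      using that by (intro sum.cong refl) (simp add: sum_distrib_right[symmetric] sum.If_cases Int_commute)
    finally show ?thesis .
  qed
  have w_side: "(\<Sum>v\<in>S i. w v) = t" if "i < 9" for i
    using w_on[of "S i"] card_line_side[OF _ that] that by (simp add: t_def)
  \<comment> \<open>Two lines share one vertex and a line has nine; so \<open>w = 0\<close> on
    \<open>V\<close> together with \<open>t = 0\<close> forces \<open>u = 0\<close>.\<close>
  have w_line: "(\<Sum>v\<in>e. w v) = 8 * u e + t" if e: "e \<in> H" for e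
  proof -
    have "(\<Sum>v\<in>e. w v) = (\<Sum>f\<in>H. of_nat (card (f \<inter> e)) * u f)" using w_on e by simp
    also have "\<dots> = (\<Sum>f\<in>H. u f + (if f = e then 8 * u e else 0))"
      using card_line[OF e] card_line_line[OF _ e] by (intro sum.cong refl) auto
    also have "\<dots> = 8 * u e + t" using e by (simp add: sum.distrib t_def)
    finally show ?thesis .
  qed
  have w_V: "(\<Sum>v\<in>V. w v) = 9 * t" using sum_V[of w] w_side by simp
  \<comment> \<open>Summing \<open>w_line\<close> over the lines through \<open>x\<close> and
    comparing with \<open>star_sum\<close> isolates \<open>w x\<close>. By
    \<open>Deg7_adjacent\<close>, only \<open>y\<close> can contribute to the far sum.\<close>
  have w7: "w x = t - (if y \<in> far x then w y else 0)" if x: "x \<in> Deg 7" for x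
  proof -
    note xV = Deg7D(1)[OF x]
    have "(\<Sum>e\<in>star x. \<Sum>v\<in>e. w v) = (\<Sum>e\<in>star x. 8 * u e + t)"
      by (rule sum.cong[OF refl]) (simp add: w_line star_def)
    also have "\<dots> = 8 * w x + 7 * t"
      using Deg7D(2)[OF x] by (simp add: sum.distrib sum_distrib_left[symmetric] w_star deg_def)
    finally have "8 * w x + 7 * t = 7 * w x + 9 * t - t - (\<Sum>v\<in>far x. w v)"
      using star_sum[OF xV, of w] Deg7D(2)[OF x] w_V w_side[OF Deg7D(3)[OF x]] by simp
    moreover have "(\<Sum>v\<in>far x. w v) = (\<Sum>v\<in>far x. if v = y then w y else 0)"
    proof (rule sum.cong[OF refl])
      fix v assume "v \<in> far x"
      then show "w v = (if v = y then w y else 0)"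
        using w0[of v] far_V Deg7_adjacent[OF 81 x] by auto
    qed
    ultimately show ?thesis by (simp add: sum.delta)
  qed
  define al where "al i = real (card (S i \<inter> Deg 7))" for i
  define mi where "mi i = real (card {x \<in> S i \<inter> Deg 7. y \<in> far x})" for i
  have own: "al i0 * t + w y = t"
  proof -
    have "w v = (if v \<in> Deg 7 then t else 0) + (if v = y then w y else 0)" if "v \<in> S i0" for v
    proof -
      have "v \<in> V" "side v = i0" using that side_subset side_eqI i0 by auto
      then show ?thesis using w7[of v] w0[of v] y sy by (auto simp: far_def)
    qed
    then have "(\<Sum>v\<in>S i0. w v) = (\<Sum>v\<in>S i0. (if v \<in> Deg 7 then t else 0) + (if v = y then w y else 0))"
      by simp
    also have "\<dots> = al i0 * t + w y"
      using y i0 by (simp add: sum.distrib sum.If_cases al_def)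
    finally show ?thesis using w_side[OF i0(1)] by simp
  qed
  have other: "al i * t - mi i * w y = t" if i: "i < 9" "i \<noteq> i0" for i
  proof -
    have "w v = (if v \<in> Deg 7 then t - (if y \<in> far v then w y else 0) else 0)" if "v \<in> S i" for v
    proof -
      have "v \<in> V" "side v = i" using that side_subset side_eqI i by auto
      then show ?thesis using w7[of v] w0[of v] sy i by auto
    qed
    then have "(\<Sum>v\<in>S i. w v) = (\<Sum>v\<in>S i. if v \<in> Deg 7 then t - (if y \<in> far v then w y else 0) else 0)"
      by simp
    also have "\<dots> = (\<Sum>v\<in>S i \<inter> Deg 7. t - (if y \<in> far v then w y else 0))"
      using i by (simp add: sum.inter_restrict)
    also have "\<dots> = al i * t - mi i * w y"
      using i by (simp add: sum_subtractf al_def mi_def sum.If_cases Int_def)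
    finally show ?thesis using w_side[OF i(1)] by simp
  qed
  \<comment> \<open>Otherwise \<open>w y = (1 - al i0) * t\<close> leaves at most one vertex of
    degree 7 on each other side, so at most 14 in all, against at least 32.\<close>
  have "t = 0"
  proof (rule ccontr)
    assume t: "t \<noteq> 0"
    have "0 < card (S i0 \<inter> Deg 7)" using x0 i0 by (auto simp: card_gt_0_iff)
    then have al0: "1 \<le> al i0" by (simp add: al_def)
    have "s 7 i \<le> 1" if i: "i < 9" "i \<noteq> i0" for i
    proof -
      have "w y = (1 - al i0) * t" using own by (simp add: algebra_simps)
      then have "al i * t - mi i * ((1 - al i0) * t) = t" using other[OF i] by simp
      then have "(al i - 1 + mi i * (al i0 - 1)) * t = 0" by (simp add: algebra_simps)
      then have "al i - 1 + mi i * (al i0 - 1) = 0" using t by simp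
      moreover have "0 \<le> mi i * (al i0 - 1)" using al0 by (simp add: mi_def)
      ultimately have "al i \<le> 1" by linarith
      then show ?thesis by (simp add: al_def s_def)
    qed
    then have "(\<Sum>i\<in>{..<9} - {i0}. s 7 i) \<le> (\<Sum>i\<in>{..<9} - {i0}. 1)" by (intro sum_mono) auto
    then have "a 7 \<le> 6 + 8"
      using s7[OF i0(1)] i0(1) sum.remove[of "{..<9}" i0 "s 7"] by (simp add: a_eq_sum_s)
    then show False using big n by simp
  qed
  then have "w y = 0" using own by simp
  then have "w v = 0" if "v \<in> V" for v using w0[OF that] w7[of v] \<open>t = 0\<close> by (cases "v \<in> Deg 7") auto
  then have "u e = 0" if "e \<in> H" for e
    using w_line[OF that] line_V[OF that] \<open>t = 0\<close> by (simp add: subset_eq)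
  then show False using u by auto
qed

end

section \<open>Vertices far from a vertex of degree 7\<close>

context linear_intersecting_9
begin

lemma Deg2_partner:
  assumes "p \<in> H" "y \<in> p" "deg y = 2"
  obtains q where "star y = {p, q}" "q \<noteq> p" "q \<in> H" "y \<in> q"
proof -
  obtain b d where bd: "star y = {b, d}" "b \<noteq> d"
    using assms(3) by (auto simp: deg_def card_2_iff)
  have "p \<in> star y" using assms by (simp add: star_def)
  then have "p = b \<or> p = d" using bd by simp
  then obtain q where q: "star y = {p, q}" "q \<noteq> p"
    using bd insert_commute[of b d "{}"] by metis
  then have "q \<in> star y" by simp
  then show thesis using that q by (simp add: star_def)
qed

text \<open>A line avoiding the vertex \<open>x\<close> of degree 7 has only one vertex far from \<open>x\<close>; hence its
  vertex of degree 2 lies on the side of \<open>x\<close> or on a second line through \<open>x\<close>.\<close>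

lemma far_partner:
  assumes x: "x \<in> Deg 7" "z \<in> far x" and p: "p \<in> H" "z \<in> p" and y: "y \<in> p" "y \<noteq> z" "star y = {p, q}"
  shows "x \<in> q \<or> side x = side y"
proof (rule ccontr)
  assume *: "\<not> ?thesis"
  have xp: "x \<notin> p" using x(2) p by (auto simp: far_def adj_def)
  have "\<not> adj x y"
  proof
    assume "adj x y"
    then obtain e where e: "e \<in> H" "x \<in> e" "y \<in> e" unfolding adj_def by (elim bexE conjE)
    then have "e \<in> star y" by (simp add: star_def)
    then show False using y(3) xp * e(2) by auto
  qed
  then have "y \<in> far x" using * y(1) line_V[OF p(1)] by (auto simp: far_def)
  then show False using far_on_line[OF x(1) p(1) y(1) p(2) _ x(2)] y(2) by simp
qed

text \<open>Each line \<open>p\<close> through \<open>z\<close> has a vertex of degree 2, with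
  second line \<open>Q p\<close>. Among three vertices of degree 7 that \<open>z\<close> is far
  from, which turn out to lie on different sides, \<open>far_partner\<close> puts two on
  \<open>Q p\<close>. Two points determine \<open>Q p\<close>, hence \<open>p\<close>; three pairs
  allow only three lines through \<open>z\<close>.\<close>

lemma card_far_le_2:
  assumes 81: "card V = 81" and n: "44 \<le> n" and z: "4 \<le> deg z" and nf: "star z \<inter> free = {}"
  shows "card {x \<in> Deg 7. z \<in> far x} \<le> 2"
proof (rule ccontr)
  let ?M = "{x \<in> Deg 7. z \<in> far x}"
  assume "\<not> card ?M \<le> 2"
  then have "3 \<le> card ?M" by simp
  then obtain X where X: "X \<subseteq> ?M" "card X = 3" by (rule obtain_subset_with_card_n)
  obtain x1 x2 x3 where x: "X = {x1, x2, x3}" "x1 \<noteq> x2" "x2 \<noteq> x3" "x1 \<noteq> x3"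
    using X(2) unfolding card_3_iff by blast
  have M: "x1 \<in> ?M" "x2 \<in> ?M" "x3 \<in> ?M" using X(1) x(1) by auto
  have "\<forall>p\<in>star z. \<exists>y q. y \<in> p \<and> deg y = 2 \<and> star y = {p, q} \<and> q \<in> H \<and> y \<in> q"
  proof
    fix p assume p: "p \<in> star z"
    have pH: "p \<in> H" "p \<notin> free" using p nf by (auto simp: star_def)
    then obtain y where y: "y \<in> p" "deg y = 2" by (auto simp: free_def Deg_def)
    obtain q where "star y = {p, q}" "q \<in> H" "y \<in> q" using Deg2_partner[OF pH(1) y] .
    then show "\<exists>y q. y \<in> p \<and> deg y = 2 \<and> star y = {p, q} \<and> q \<in> H \<and> y \<in> q"
      using y by (intro exI conjI)
  qed
  from bchoice[OF this] obtain Y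
    where "\<forall>p\<in>star z. \<exists>q. Y p \<in> p \<and> deg (Y p) = 2 \<and> star (Y p) = {p, q} \<and> q \<in> H \<and> Y p \<in> q" ..
  from bchoice[OF this] obtain Q
    where YQ: "\<forall>p\<in>star z. Y p \<in> p \<and> deg (Y p) = 2 \<and> star (Y p) = {p, Q p} \<and> Q p \<in> H \<and> Y p \<in> Q p" ..
  have Y: "Y p \<in> p" "deg (Y p) = 2" "Y p \<noteq> z" "star (Y p) = {p, Q p}" and Q: "Q p \<in> H" "Y p \<in> Q p"
    if "p \<in> star z" for p
    using bspec[OF YQ that] z by auto
  have H: "p \<in> H" "z \<in> p" if "p \<in> star z" for p using that by (auto simp: star_def)
  have inj: "p = q" if p: "p \<in> star z" and q: "q \<in> star z" and e: "Y p = Y q" for p q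
  proof (rule same_line[of p q "Y p" z])
    show "Y p \<in> q" using Y(1)[OF q] e by simp
  qed (use p q H Y in auto)
  have injQ: "p = q" if p: "p \<in> star z" and q: "q \<in> star z" and e: "Q p = Q q" for p q
  proof (rule inj[OF p q])
    have "Y q \<in> Q p" using Q(2)[OF q] e by simp
    then show "Y p = Y q" using deg_2_unique[OF Q(1)[OF p] Q(2)[OF p] Y(2)[OF p]] Y(2)[OF q] by simp
  qed
  have miss: "x \<in> Q p \<or> side x = side (Y p)" if "x \<in> ?M" "p \<in> star z" for x p
    using that far_partner[of x z p "Y p" "Q p"] H Y by simp
  \<comment> \<open>No \<open>Q p\<close> contains two vertices of one side, so all
    \<open>Y p\<close> would lie on that side: four vertices of degree 2 among nine give degree sum
    at most \<open>8 + 35 = 43\<close>.\<close>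
  have side_ne: "side u \<noteq> side v" if u: "u \<in> ?M" and v: "v \<in> ?M" and ne: "u \<noteq> v" for u v
  proof
    assume e: "side u = side v"
    define i where "i = side u"
    have i: "i < 9" using u Deg7D by (auto simp: i_def)
    have sy: "side (Y p) = i" if p: "p \<in> star z" for p
    proof (rule ccontr)
      assume "side (Y p) \<noteq> i"
      then have "u \<in> Q p" "v \<in> Q p" using miss[OF u p] miss[OF v p] e by (auto simp: i_def)
      then show False using line_side_unique[OF Q(1)[OF p]] e ne by simp
    qed
    have "Y ` star z \<subseteq> S i \<inter> Deg 2"
    proof
      fix y assume "y \<in> Y ` star z"
      then obtain p where p: "p \<in> star z" "y = Y p" by auto
      have "y \<in> V" using Y(1)[OF p(1)] line_V[OF H(1)[OF p(1)]] p(2) by auto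
      then show "y \<in> S i \<inter> Deg 2" using sideD(2)[of y] sy[OF p(1)] Y(2)[OF p(1)] p(2) by (simp add: Deg_def)
    qed
    then have "card (Y ` star z) \<le> card (S i \<inter> Deg 2)" using i by (intro card_mono) auto
    moreover have "card (Y ` star z) = deg z"
      unfolding deg_def by (rule card_image) (use inj in \<open>auto simp: inj_on_def\<close>)
    ultimately have "4 \<le> s 2 i" using z by (simp add: s_def)
    then show False using side_profile[OF i] card_side_9[OF 81 i] n
      s_nonneg[of 3 i] s_nonneg[of 4 i] s_nonneg[of 5 i] s_nonneg[of 6 i] by linarith
  qed
  define B where "B u v = {p \<in> star z. u \<in> Q p \<and> v \<in> Q p}" for u v
  have B: "card (B u v) \<le> 1" if "u \<noteq> v" for u v
  proof -
    have "p = q" if "p \<in> B u v" "q \<in> B u v" for p q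
      using that injQ same_line[of "Q p" "Q q" u v] Q(1) \<open>u \<noteq> v\<close> by (auto simp: B_def)
    then show ?thesis by (subst One_nat_def, subst card_le_Suc0_iff_eq) (auto simp: B_def)
  qed
  have "star z \<subseteq> B x1 x2 \<union> B x1 x3 \<union> B x2 x3"
  proof
    fix p assume p: "p \<in> star z"
    show "p \<in> B x1 x2 \<union> B x1 x3 \<union> B x2 x3"
      using miss[OF M(1) p] miss[OF M(2) p] miss[OF M(3) p]
        side_ne[OF M(1,2) x(2)] side_ne[OF M(2,3) x(3)] side_ne[OF M(1,3) x(4)] p
      by (auto simp: B_def)
  qed
  then have "deg z \<le> card (B x1 x2 \<union> B x1 x3 \<union> B x2 x3)"
    unfolding deg_def by (intro card_mono) (auto simp: B_def)
  also have "\<dots> \<le> card (B x1 x2) + card (B x1 x3) + card (B x2 x3)"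
    by (intro order_trans[OF card_Un_le] add_right_mono card_Un_le)
  finally show False using B[OF x(2)] B[OF x(3)] B[OF x(4)] z by simp
qed

text \<open>One line through \<open>z\<close> that is not free suffices: by
  \<open>far_partner\<close>, \<open>x\<close> is one of 8 vertices of \<open>q\<close> or one of at
  most 5 on the side of \<open>y\<close>.\<close>

lemma card_far_le_13:
  assumes n: "n \<le> 45" and p: "p \<in> star z" "p \<notin> free" and z: "4 \<le> deg z"
  shows "card {x \<in> Deg 7. z \<in> far x} \<le> 13"
proof -
  have pH: "p \<in> H" "z \<in> p" using p by (auto simp: star_def)
  then obtain y where y: "y \<in> p" "deg y = 2" using p(2) by (auto simp: free_def Deg_def)
  obtain q where q: "star y = {p, q}" "q \<in> H" "y \<in> q" using Deg2_partner[OF pH(1) y] .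
  have yz: "y \<noteq> z" using z y by auto
  have yV: "y \<in> V" using line_V pH(1) y(1) by auto
  have i: "side y < 9" using sideD[OF yV] by simp
  have "{x \<in> Deg 7. z \<in> far x} \<subseteq> (q - {y}) \<union> (S (side y) \<inter> Deg 7)"
  proof
    fix x assume "x \<in> {x \<in> Deg 7. z \<in> far x}"
    then have x: "x \<in> Deg 7" "z \<in> far x" by simp_all
    have "x \<noteq> y" using x(1) y(2) by (auto simp: Deg_def)
    then show "x \<in> (q - {y}) \<union> (S (side y) \<inter> Deg 7)"
      using far_partner[OF x pH y(1) yz q(1)] Deg7D(4)[OF x(1)] x(1) by auto
  qed
  then have "card {x \<in> Deg 7. z \<in> far x} \<le> card ((q - {y}) \<union> (S (side y) \<inter> Deg 7))"
    using q(2) i by (intro card_mono) auto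
  also have "\<dots> \<le> card (q - {y}) + card (S (side y) \<inter> Deg 7)" by (rule card_Un_le)
  also have "card (q - {y}) = 8" using card_line[OF q(2)] q by simp
  also have "card (S (side y) \<inter> Deg 7) \<le> 5" using s7_le[OF i] n by (simp add: s_def)
  finally show ?thesis by simp
qed

text \<open>A vertex on the free line still has a line that is not free, so its bound is 13 instead
  of 2; the difference is the factor 11.\<close>

lemma E_le:
  assumes 81: "card V = 81" and n: "44 \<le> n" "n \<le> 45" and fr: "card free \<le> 1" and k: "4 \<le> k"
  shows "E k \<le> 2 * a k + 11 * Fr k"
proof -
  have ff: "finite free" by (simp add: free_def)
  have "E k = (\<Sum>x\<in>Deg 7. \<Sum>z\<in>Deg k. if z \<in> far x then 1 else 0)"
    unfolding E_def by (rule sum.cong[OF refl]) (simp add: sum.If_cases Int_commute)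
  also have "\<dots> = (\<Sum>z\<in>Deg k. \<Sum>x\<in>Deg 7. if z \<in> far x then 1 else 0)" by (rule sum.swap)
  also have "\<dots> = (\<Sum>z\<in>Deg k. int (card {x \<in> Deg 7. z \<in> far x}))"
    by (rule sum.cong[OF refl]) (simp add: sum.If_cases Int_def)
  also have "\<dots> \<le> (\<Sum>z\<in>Deg k. 2 + 11 * int (card (star z \<inter> free)))"
  proof (rule sum_mono)
    fix z assume "z \<in> Deg k"
    then have z: "4 \<le> deg z" using k by (simp add: Deg_def)
    show "int (card {x \<in> Deg 7. z \<in> far x}) \<le> 2 + 11 * int (card (star z \<inter> free))"
    proof (cases "star z \<inter> free = {}")
      case True
      then show ?thesis using card_far_le_2[OF 81 n(1) z] by simp
    next
      case False
      then have pos: "0 < card (star z \<inter> free)" by (simp add: card_gt_0_iff)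
      have "\<not> star z \<subseteq> free"
      proof
        assume "star z \<subseteq> free"
        then have "deg z \<le> card free" unfolding deg_def by (rule card_mono[OF ff])
        then show False using fr z by simp
      qed
      then obtain p where "p \<in> star z" "p \<notin> free" by blast
      then have "card {x \<in> Deg 7. z \<in> far x} \<le> 13" using card_far_le_13[OF n(2) _ _ z] by simp
      then show ?thesis using pos by simp
    qed
  qed
  also have "\<dots> = 2 * a k + 11 * (\<Sum>z\<in>Deg k. int (card (star z \<inter> free)))"
    by (simp add: sum.distrib sum_distrib_left a_def)
  also have "(\<Sum>z\<in>Deg k. int (card (star z \<inter> free))) = (\<Sum>z\<in>Deg k. \<Sum>e\<in>free. if z \<in> e then 1 else 0)"
  proof (rule sum.cong[OF refl])
    fix z
    have "star z \<inter> free = free \<inter> {e. z \<in> e}" by (auto simp: star_def free_def)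
    then show "int (card (star z \<inter> free)) = (\<Sum>e\<in>free. if z \<in> e then 1 else 0)"
      using ff by (simp add: sum.If_cases)
  qed
  also have "\<dots> = (\<Sum>e\<in>free. \<Sum>z\<in>Deg k. if z \<in> e then 1 else 0)" by (rule sum.swap)
  also have "\<dots> = (\<Sum>e\<in>free. c k e)"
    by (rule sum.cong[OF refl]) (simp add: sum.If_cases c_def Int_commute)
  also have "\<dots> = (\<Sum>e\<in>H. if e \<in> free then c k e else 0)"
    by (simp add: sum.If_cases free_def Int_def)
  also have "\<dots> = Fr k" unfolding Fr_def
  proof (rule sum.cong[OF refl])
    fix e assume e: "e \<in> H"
    show "(if e \<in> free then c k e else 0) = (1 - c 2 e) * c k e"
    proof (cases "e \<in> free")
      case True
      then show ?thesis by (simp add: free_def c_def)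
    next
      case False
      then have "0 < card (e \<inter> Deg 2)" using e by (simp add: free_def card_gt_0_iff)
      then have "c 2 e = 1" using card_line_Deg2[OF e] by (simp add: c_def)
      then show ?thesis using False by simp
    qed
  qed
  finally show ?thesis .
qed

end

section \<open>Linear programming certificates\<close>

context linear_intersecting_9
begin

text \<open>Lines and sides use the same \<open>h4\<close> to \<open>h7\<close>, so that
  \<open>CC_eq\<close> cancels the unknown \<open>T k\<close>.\<close>

lemma certificate:
  assumes L: "all_profiles (n + 8) (\<lambda>c2 c3 c4 c5 c6 c7. 0 \<le> G + f2*c2 + f3*c3 + f4*c4 + f5*c5 + f6*c6 + f7*c7
     + h4*(c7*c4) + h5*(c7*c5) + h6*(c7*c6) + h7*(c7*c7) + p4*((1-c2)*c4) + p5*((1-c2)*c5))"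
    and S: "all_sides (n - 18) (\<lambda>s4 s5 s6 s7. 0 \<le> D + F4*s4 + F5*s5 + F6*s6 + F7*s7
     + h4*(s7*s4) + h5*(s7*s5) + h6*(s7*s6) + h7*(s7*s7))"
  shows "0 \<le> n*G + 9*D + f2*(2*a 2) + f3*(3*a 3) + f4*(4*a 4) + f5*(5*a 5) + f6*(6*a 6) + f7*(7*a 7)
     + F4*a 4 + F5*a 5 + F6*a 6 + F7*a 7 + h4*(a 7*a 4 - E 4) + h5*(a 7*a 5 - E 5) + h6*(a 7*a 6 - E 6)
     + h7*(a 7*a 7 + 7*a 7 - E 7) + p4*Fr 4 + p5*Fr 5"
  using line_cert[OF L] side_cert[OF S] CC_eq[of 4] CC_eq[of 5] CC_eq[of 6] CC_eq[of 7]
  by (simp add: algebra_simps)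

text \<open>The coefficients are Farkas multipliers found by linear programming.\<close>

lemma no_n_43_a7_le_25:
  assumes 81: "card V = 81" and n: "n = 43" and A: "a 7 = 22 \<or> a 7 = 23 \<or> a 7 = 24 \<or> a 7 = 25"
  shows False
proof -
  have L: "all_profiles (43 + 8) (\<lambda>c2 c3 c4 c5 c6 c7. 0 \<le> 2301 + (- 2887)*c2 + (- 2082)*c3 + (- 1277)*c4 + (- 506)*c5 + 0*c6 + 0*c7
     + 0*(c7*c4) + 0*(c7*c5) + 69*(c7*c6) + 115*(c7*c7) + 0*((1-c2)*c4) + 0*((1-c2)*c5))"
    by code_simp
  have S: "all_sides (43 - 18) (\<lambda>s4 s5 s6 s7. 0 \<le> 1380 + 0*s4 + 0*s5 + (- 207)*s6 + (- 805)*s7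
     + 0*(s7*s4) + 0*(s7*s5) + 69*(s7*s6) + 115*(s7*s7))"
    by code_simp
  note C = certificate[unfolded n, OF L S, unfolded E_7[OF 81]]
  have a2: "a 2 \<le> 21" using a2_le n by simp
  \<comment> \<open>Once \<open>a 7\<close> is a number, the products \<open>a 7 * a k\<close> are
    linear and linear arithmetic finishes.\<close>
  from A show False
    by (elim disjE; use C Deg_identities[unfolded n 81]
        a_nonneg[of 2] a_nonneg[of 3] a_nonneg[of 4] a_nonneg[of 5] a_nonneg[of 6] E_nonneg[of 6]
        a2 in simp)
qed

lemma no_n_43_a7_26:
  assumes 81: "card V = 81" and n: "n = 43" and A: "a 7 = 26"
  shows False
proof -
  have L: "all_profiles (43 + 8) (\<lambda>c2 c3 c4 c5 c6 c7. 0 \<le> 138 + (- 156)*c2 + (- 114)*c3 + (- 72)*c4 + (- 30)*c5 + 0*c6 + 0*c7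
     + 0*(c7*c4) + 0*(c7*c5) + 3*(c7*c6) + 6*(c7*c7) + 0*((1-c2)*c4) + 0*((1-c2)*c5))"
    by code_simp
  have S: "all_sides (43 - 18) (\<lambda>s4 s5 s6 s7. 0 \<le> 72 + 0*s4 + 0*s5 + (- 9)*s6 + (- 42)*s7
     + 0*(s7*s4) + 0*(s7*s5) + 3*(s7*s6) + 6*(s7*s7))"
    by code_simp
  note C = certificate[unfolded n, OF L S, unfolded E_7[OF 81]]
  have a2: "a 2 \<le> 21" using a2_le n by simp
  show False
    by (use A C Deg_identities[unfolded n 81]
        a_nonneg[of 2] a_nonneg[of 3] a_nonneg[of 4] a_nonneg[of 5] a_nonneg[of 6] E_nonneg[of 6]
        a2 in simp)
qed

lemma no_n_44_a2_le_21:
  assumes 81: "card V = 81" and n: "n = 44" and A: "a 7 = 27 \<or> a 7 = 28 \<or> a 7 = 29" and a2: "a 2 \<le> 21"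
  shows False
proof -
  have L: "all_profiles (44 + 8) (\<lambda>c2 c3 c4 c5 c6 c7. 0 \<le> 7006 + (- 11598)*c2 + (- 8313)*c3 + (- 5028)*c4 + (- 1961)*c5 + 0*c6 + 0*c7
     + 0*(c7*c4) + 0*(c7*c5) + 243*(c7*c6) + 419*(c7*c7) + 0*((1-c2)*c4) + 0*((1-c2)*c5))"
    by code_simp
  have S: "all_sides (44 - 18) (\<lambda>s4 s5 s6 s7. 0 \<le> 7240 + 0*s4 + 0*s5 + (- 972)*s6 + (- 3486)*s7
     + 0*(s7*s4) + 0*(s7*s5) + 243*(s7*s6) + 419*(s7*s7))"
    by code_simp
  note C = certificate[unfolded n, OF L S, unfolded E_7[OF 81]]
  from A show False
    by (elim disjE; use C Deg_identities[unfolded n 81]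
        a_nonneg[of 2] a_nonneg[of 3] a_nonneg[of 4] a_nonneg[of 5] a_nonneg[of 6] E_nonneg[of 6]
        a2 in simp)
qed

text \<open>Here all lines have a vertex of degree 2; adding \<open>100000 * (1 - c2)\<close> makes the line inequality
  vacuous for \<open>c2 = 0\<close>.\<close>

lemma no_n_44_a2_22:
  assumes 81: "card V = 81" and n: "n = 44" and A: "a 7 = 27 \<or> a 7 = 28 \<or> a 7 = 29" and a2: "a 2 = 22"
  shows False
proof -
  have L: "all_profiles (44 + 8) (\<lambda>c2 c3 c4 c5 c6 c7. 0 \<le> 100525 + (- 100609)*c2 + (- 441)*c3 + (- 176)*c4 + (- 42)*c5 + 0*c6 + 0*c7
     + (- 19)*(c7*c4) + (- 21)*(c7*c5) + 0*(c7*c6) + 21*(c7*c7) + 0*((1-c2)*c4) + 0*((1-c2)*c5))"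
    by code_simp
  have S: "all_sides (44 - 18) (\<lambda>s4 s5 s6 s7. 0 \<le> 126 + 62*s4 + 63*s5 + 0*s6 + (- 105)*s7
     + (- 19)*(s7*s4) + (- 21)*(s7*s5) + 0*(s7*s6) + 21*(s7*s7))"
    by code_simp
  note C = certificate[unfolded n, OF L S, unfolded E_7[OF 81]]
  have fr: "int (card free) = 0" using card_free a2 n by simp
  then have nf: "free = {}" by (simp add: free_def)
  have c2: "c 2 e = 1" if e: "e \<in> H" for e
  proof -
    have "e \<inter> Deg 2 \<noteq> {}" using nf e by (auto simp: free_def)
    then have "0 < card (e \<inter> Deg 2)" using e by (simp add: card_gt_0_iff)
    then show ?thesis using card_line_Deg2[OF e] by (simp add: c_def)
  qed
  have F: "Fr k = 0" for k unfolding Fr_def by (rule sum.neutral) (simp add: c2)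
  \<comment> \<open>The coefficients \<open>h4\<close> and \<open>h5\<close> are negative here, so
    \<open>E 4\<close> and \<open>E 5\<close> must be bounded from above.\<close>
  have E4: "E 4 \<le> 2 * a 4" and E5: "E 5 \<le> 2 * a 5"
    using E_le[OF 81, of 4] E_le[OF 81, of 5] n fr by (simp_all add: F)
  from A show False
    by (elim disjE; use C Deg_identities[unfolded n 81]
        a_nonneg[of 2] a_nonneg[of 3] a_nonneg[of 4] a_nonneg[of 5] a_nonneg[of 6] E_nonneg[of 6]
        E4 E5 F[of 4] F[of 5] a2 in simp)
qed

lemma no_n_45_a2_le_21:
  assumes 81: "card V = 81" and n: "n = 45" and A: "a 7 = 32 \<or> a 7 = 33" and a2: "a 2 \<le> 21"
  shows False
proof -
  have L: "all_profiles (45 + 8) (\<lambda>c2 c3 c4 c5 c6 c7. 0 \<le> 1060 + (- 2455)*c2 + (- 1755)*c3 + (- 1055)*c4 + (- 409)*c5 + 0*c6 + 0*c7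
     + 0*(c7*c4) + 0*(c7*c5) + 45*(c7*c6) + 80*(c7*c7) + 0*((1-c2)*c4) + 0*((1-c2)*c5))"
    by code_simp
  have S: "all_sides (45 - 18) (\<lambda>s4 s5 s6 s7. 0 \<le> 1500 + 0*s4 + 0*s5 + (- 180)*s6 + (- 695)*s7
     + 0*(s7*s4) + 0*(s7*s5) + 45*(s7*s6) + 80*(s7*s7))"
    by code_simp
  note C = certificate[unfolded n, OF L S, unfolded E_7[OF 81]]
  from A show False
    by (elim disjE; use C Deg_identities[unfolded n 81]
        a_nonneg[of 2] a_nonneg[of 3] a_nonneg[of 4] a_nonneg[of 5] a_nonneg[of 6] E_nonneg[of 6]
        a2 in simp)
qed

lemma no_n_45_a2_22:
  assumes 81: "card V = 81" and n: "n = 45" and A: "a 7 = 32 \<or> a 7 = 33" and a2: "a 2 = 22"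
  shows False
proof -
  have L: "all_profiles (45 + 8) (\<lambda>c2 c3 c4 c5 c6 c7. 0 \<le> 178285 + (- 298824)*c2 + (- 205657)*c3 + (- 119106)*c4 + (- 51693)*c5 + 0*c6 + 0*c7
     + (- 1044)*(c7*c4) + (- 522)*(c7*c5) + 3144*(c7*c6) + 8537*(c7*c7) + (- 11484)*((1-c2)*c4) + (- 5742)*((1-c2)*c5))"
    by code_simp
  have S: "all_sides (45 - 18) (\<lambda>s4 s5 s6 s7. 0 \<le> 230082 + (- 1818)*s4 + (- 3906)*s5 + (- 24564)*s6 + (- 87173)*s7
     + (- 1044)*(s7*s4) + (- 522)*(s7*s5) + 3144*(s7*s6) + 8537*(s7*s7))"
    by code_simp
  note C = certificate[unfolded n, OF L S, unfolded E_7[OF 81]]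
  have fr: "int (card free) = 1" using card_free a2 n by simp
  \<comment> \<open>In the certificate \<open>p4 = 11 * h4\<close> and \<open>p5 = 11 * h5\<close>,
    so the terms \<open>11 * Fr k\<close> of these bounds cancel.\<close>
  have E4: "E 4 \<le> 2 * a 4 + 11 * Fr 4" and E5: "E 5 \<le> 2 * a 5 + 11 * Fr 5"
    using E_le[OF 81, of 4] E_le[OF 81, of 5] n fr by simp_all
  from A show False
    by (elim disjE; use C Deg_identities[unfolded n 81]
        a_nonneg[of 2] a_nonneg[of 3] a_nonneg[of 4] a_nonneg[of 5] a_nonneg[of 6] E_nonneg[of 6]
        E4 E5 a2 in simp)
qed

lemma contradiction: False
proof (rule n_cases)
  assume *: "n = 43" "a 7 \<in> {22, 23, 24, 25, 26}" "card V = 81"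
  then show False using no_n_43_a7_le_25[OF *(3,1)] no_n_43_a7_26[OF *(3,1)] by auto
next
  assume *: "n = 44" "a 7 \<in> {27, 28, 29}" "card V = 81"
  \<comment> \<open>For 44 or 45 lines, \<open>a 2 = 22\<close> means at most one free line, the
    situation of \<open>E_le\<close>.\<close>
  have "a 2 \<le> 21 \<or> a 2 = 22" using a2_le *(1) by auto
  then show False using no_n_44_a2_le_21[OF *(3,1)] no_n_44_a2_22[OF *(3,1)] *(2) by auto
next
  assume *: "n = 45" "a 7 \<in> {32, 33}" "card V = 81"
  have "a 2 \<le> 21 \<or> a 2 = 22" using a2_le *(1) by auto
  then show False using no_n_45_a2_le_21[OF *(3,1)] no_n_45_a2_22[OF *(3,1)] *(2) by auto
next
  assume "46 \<le> n" "n \<le> 49" "35 \<le> a 7" "card V = 81"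
  then show False using a7_le by simp
qed

end

lemma (in linear_intersecting_partite) r_gt_9: "9 < r"
proof (rule ccontr)
  assume "\<not> 9 < r"
  then have "r = 9 \<and> (\<exists>x\<in>V. deg x = 7)" by (intro r_eq_9) simp
  note r = conjunct1[OF this] and ex = conjunct2[OF this]
  have "Deg 7 \<noteq> {}" using ex by (auto simp: Deg_def)
  then have "linear_intersecting_9 H S"
    using linear_intersecting_partite_axioms unfolding r
    by (simp add: linear_intersecting_9_def linear_intersecting_9_axioms_def)
  then show False by (rule linear_intersecting_9.contradiction)
qed

theorem theorem2p9:
  fixes V :: "'a set" and H :: "'a set set" and r :: nat
  assumes "2 \<le> r" and "r \<le> 9"
    and "hypergraph V H"
    and "r_partite r V H"
    and "linear_hypergraph H"
    and "intersecting_hypergraph H"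
    and "\<forall>v\<in>V. 0 < vertex_degree H v"
  shows "covering_number V H \<le> r - 1"
proof (rule ccontr)
  assume big: "\<not> covering_number V H \<le> r - 1"
  have fV: "finite V" and lines: "\<And>e. e \<in> H \<Longrightarrow> e \<subseteq> V"
    using assms(3) by (auto simp: hypergraph_def)
  obtain S where S: "(\<Union>i<r. S i) = V" "disjoint_family_on S {..<r}"
    and ex1: "\<And>e i. e \<in> H \<Longrightarrow> i < r \<Longrightarrow> \<exists>!v. v \<in> e \<inter> S i"
    using assms(4) by (auto simp: r_partite_def)
  have "linear_intersecting_partite H S r"
  proof
    show "2 \<le> r" by (rule assms(1))
    show "finite (S i)" if "i < r" for i
      by (rule finite_subset[OF _ fV]) (use S(1) that in blast)
    show "disjoint_family_on S {..<r}" by (rule S(2))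
    show "e \<subseteq> (\<Union>i<r. S i)" if "e \<in> H" for e using lines[OF that] S(1) by simp
    show "card (e \<inter> S i) = 1" if ei: "e \<in> H" "i < r" for e i
    proof -
      obtain v where "v \<in> e \<inter> S i" "\<And>w. w \<in> e \<inter> S i \<Longrightarrow> w = v" using ex1[OF ei] by (elim ex1E) blast
      then have "e \<inter> S i = {v}" by blast
      then show ?thesis by simp
    qed
    show "card (e \<inter> f) = 1" if "e \<in> H" "f \<in> H" "e \<noteq> f" for e f
    proof -
      have "card (e \<inter> f) \<le> 1" using assms(5) that by (simp add: linear_hypergraph_def)
      moreover have "e \<inter> f \<noteq> {}" using assms(6) that by (simp add: intersecting_hypergraph_def)
      moreover have "finite (e \<inter> f)" using finite_subset[OF lines fV] that by blast
      ultimately show ?thesis using card_gt_0_iff[of "e \<inter> f"] by simp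
    qed
    show "\<exists>e\<in>H. v \<in> e" if "v \<in> (\<Union>i<r. S i)" for v
    proof -
      have "{e \<in> H. v \<in> e} \<noteq> {}" using assms(7) that unfolding S(1) vertex_degree_def by (metis card.empty less_irrefl)
      then show ?thesis by blast
    qed
    show "\<exists>e\<in>H. C \<inter> e = {}" if C: "C \<subseteq> (\<Union>i<r. S i)" "card C < r" for C
    proof (rule ccontr)
      assume "\<not> ?thesis"
      then have "is_cover V H C" using C(1) S(1) by (auto simp: is_cover_def)
      moreover have "finite {C. is_cover V H C}"
        by (rule finite_subset[of _ "Pow V"]) (auto simp: is_cover_def fV)
      ultimately have "covering_number V H \<le> card C" unfolding covering_number_def by (intro Min_le) auto
      then show False using big C(2) by simp
    qed
  qed
  then show False using linear_intersecting_partite.r_gt_9 assms(2) by fastforce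
qed

end
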